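(* Let $f=h+\overline{g}\in\mathcal{S}_H(\mathcal{S})$ with $b_1=f_{\overline{z}}(0)$. Then for any $z\in\mathbb{D}$ the Jacobian $J_f(z)=|h'(z)|^2-|g'(z)|^2$ satisfies the bounds $$(1-|b_1|^2)\frac{(1-|z|)^3}{(1+|z|)^7}\le J_f(z)\le(1-|b_1|^2)\frac{(1+|z|)^3}{(1-|z|)^7}.$$ These bounds are sharp. Equality is attained for the close-to-convex functions $f(z)=K(z)+\overline{b_1K(z)}$, where $K$ is the harmonic Koebe function $$K(z)=\frac{z-\frac12z^2+\frac16z^3}{(1-z)^3}+\overline{\left(\frac{\frac12z^2+\frac16z^3}{(1-z)^3}\right)}.$$
   Context: $\mathbb{D}=\{z\in\mathbb{C}:|z|<1\}$. $\mathcal{H}$ is the class of complex-valued harmonic functions $f=h+\overline{g}$ in $\mathbb{D}$ with $h,g$ analytic in $\mathbb{D}$, $h(0)=g(0)=0$, $h'(0)=1$. Such an $f$ is (locally univalent and) sense-preserving if $|h'(z)|^2-|g'(z)|^2>0$ for all $z\in\mathbb{D}$. $\mathcal{S}_H$ is the class of all sense-preserving univalent (injective) $f\in\mathcal{H}$, and $\mathcal{S}^0_H$ is the class of $f\in\mathcal{S}_H$ with $f_{\overline{z}}(0)=0$ (i.e. $g'(0)=0$). $\mathcal{S}$ is the class of analytic univalent functions $\varphi$ on $\mathbb{D}$ with $\varphi(0)=0$, $\varphi'(0)=1$. Define $$\mathcal{S}^0_H(\mathcal{S})=\{h+\overline{g}\in\mathcal{S}^0_H:\ h+e^{i\theta}g\in\mathcal{S}\text{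 for some }\theta\in\mathbb{R}\},$$ $$\mathcal{S}_H(\mathcal{S})=\{f=f_0+c\,\overline{f_0}:\ f_0\in\mathcal{S}^0_H(\mathcal{S}),\ c\in\mathbb{D}\}.$$ A function in $\mathcal{S}_H$ is close-to-convex if its range $f(\mathbb{D})$ is a close-to-convex domain (its complement is a union of closed half-lines with pairwise disjoint interiors). *)

theory Defs
  imports "HOL-Complex_Analysis.Complex_Analysis"
begin

abbreviation unit_disc :: "complex set" (\<open>\<bbbD>\<close>) where
  "\<bbbD> \<equiv> ball 0 1"

text \<open>
  All functions are total on the complex plane, but only their values on the open unit disc matter:
  the classes below are closed under changing a function outside the disc.
\<close>

text \<open>The Wirtinger derivative \<open>(f\<^sub>x + \<i> f\<^sub>y) / 2\<close>, with \<open>f\<^sub>x\<close>, \<open>f\<^sub>y\<close> the directional derivatives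
  along \<open>1\<close> and \<open>\<i>\<close>.\<close>

definition dbar :: "(complex \<Rightarrow> complex) \<Rightarrow> complex \<Rightarrow> complex" where
  "dbar f z = (frechet_derivative f (at z) 1 + \<i> * frechet_derivative f (at z) \<i>) / 2"

text \<open>\<open>f = h + cnj g\<close> belongs to the class \<open>\<H>\<close>; the parts \<open>h\<close> and \<open>g\<close> are determined by \<open>f\<close> on the
  disc.\<close>

definition canonical_decomp ::
    "(complex \<Rightarrow> complex) \<Rightarrow> (complex \<Rightarrow> complex) \<Rightarrow> (complex \<Rightarrow> complex) \<Rightarrow> bool" where
  "canonical_decomp f h g \<longleftrightarrow>
     h holomorphic_on \<bbbD> \<and> g holomorphic_on \<bbbD> \<and> h 0 = 0 \<and> g 0 = 0 \<and> deriv h 0 = 1 \<and>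
     (\<forall>z\<in>\<bbbD>. f z = h z + cnj (g z))"

definition harmonic_jacobian :: "(complex \<Rightarrow> complex) \<Rightarrow> (complex \<Rightarrow> complex) \<Rightarrow> complex \<Rightarrow> real" where
  "harmonic_jacobian h g z = (cmod (deriv h z))\<^sup>2 - (cmod (deriv g z))\<^sup>2"

definition class_S :: "(complex \<Rightarrow> complex) set" where
  "class_S = {\<phi>. \<phi> holomorphic_on \<bbbD> \<and> inj_on \<phi> \<bbbD> \<and> \<phi> 0 = 0 \<and> deriv \<phi> 0 = 1}"

definition class_SH :: "(complex \<Rightarrow> complex) set" where
  "class_SH = {f. (\<exists>h g. canonical_decomp f h g \<and> (\<forall>z\<in>\<bbbD>. harmonic_jacobian h g z > 0)) \<and> inj_on f \<bbbD>}"

definition class_SH0 :: "(complex \<Rightarrow> complex) set" where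
  "class_SH0 = {f \<in> class_SH. dbar f 0 = 0}"

definition class_SH0_S :: "(complex \<Rightarrow> complex) set" where
  "class_SH0_S = {f \<in> class_SH0.
     \<exists>h g. canonical_decomp f h g \<and> (\<exists>\<theta>::real. (\<lambda>z. h z + exp (\<i> * of_real \<theta>) * g z) \<in> class_S)}"

definition class_SH_S :: "(complex \<Rightarrow> complex) set" where
  "class_SH_S = {f. \<exists>f0\<in>class_SH0_S. \<exists>c\<in>\<bbbD>. \<forall>z\<in>\<bbbD>. f z = f0 z + c * cnj (f0 z)}"

definition closed_half_line :: "complex set \<Rightarrow> bool" where
  "closed_half_line L \<longleftrightarrow> (\<exists>a d. d \<noteq> 0 \<and> L = {a + t *\<^sub>R d |t. t \<ge> 0})"

text \<open>A half-line has empty interior in the plane; its interior is meant relative to the line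
  carrying it, i.e. the half-line without its endpoint.\<close>

definition close_to_convex_domain :: "complex set \<Rightarrow> bool" where
  "close_to_convex_domain \<Omega> \<longleftrightarrow>
     open \<Omega> \<and> connected \<Omega> \<and> \<Omega> \<noteq> {} \<and>
     (\<exists>\<L>. (\<forall>L\<in>\<L>. closed_half_line L) \<and>
          pairwise (\<lambda>L M. disjnt (rel_interior L) (rel_interior M)) \<L> \<and>
          - \<Omega> = \<Union>\<L>)"

definition close_to_convex :: "(complex \<Rightarrow> complex) \<Rightarrow> bool" where
  "close_to_convex f \<longleftrightarrow> f \<in> class_SH \<and> close_to_convex_domain (f ` \<bbbD>)"

definition harmonic_koebe :: "complex \<Rightarrow> complex" where
  "harmonic_koebe z =
     (z - 1/2 * z^2 + 1/6 * z^3) / (1 - z)^3 + cnj ((1/2 * z^2 + 1/6 * z^3) / (1 - z)^3)"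

end

theory Submission
  imports Defs
begin

text \<open>
  If \<open>f = f\<^sub>0 + c cnj f\<^sub>0\<close> with \<open>f\<^sub>0 = h + cnj g\<close>, then \<open>J\<^sub>f = (1 - |c|\<^sup>2) J\<close>, where \<open>J\<close> is the Jacobian of
  \<open>f\<^sub>0\<close>, and \<open>c = b\<^sub>1\<close>. For the shear \<open>\<phi> = h + e\<^sup>i\<^sup>\<theta> g\<close> and the dilatation \<open>\<omega> = g'/h'\<close>,
  \<open>J = |\<phi>'|\<^sup>2 (1 - |\<omega>|\<^sup>2) / |1 + e\<^sup>i\<^sup>\<theta> \<omega>|\<^sup>2\<close>; the first factor is controlled by Koebe's distortion theorem
  and the second by \<open>|\<omega>(z)| \<le> |z|\<close> (Schwarz).

  The distortion theorem rests on Bieberbach's inequality, i.e. on \<open>|b| \<le> 1\<close> for an injective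
  \<open>1/z + b z + \<dots>\<close>. This is proved by comparing areas: the image of the annulus
  \<open>\<rho> < |z| < r\<close> has area at least \<open>\<pi> (1/\<rho>\<^sup>2 - 1/r\<^sup>2 + |b|\<^sup>2 (r\<^sup>2 - \<rho>\<^sup>2))\<close>, and by the maximum principle
  it lies in an ellipse of area \<open>\<pi>/\<rho>\<^sup>2 + o(1)\<close>.

  For sharpness, \<open>u = (1 + z)/(1 - z) = a + \<i> b\<close> turns the harmonic Koebe function into the polynomial map
  \<open>((a\<^sup>3 - 3 a b\<^sup>2 - 1)/6, a b/2)\<close> on the right half-plane, whose injectivity and range (the plane slit
  along \<open>(-\<infinity>, -1/6]\<close>) are elementary; the slit is carried to a half-line by \<open>w \<mapsto> w + c cnj w\<close>.
\<close>

subsection \<open>Area of a conformal image\<close>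

text \<open>The change of variables formula for measures is available on \<open>real ^ 'n\<close> only.\<close>

definition vec_of_complex :: "complex \<Rightarrow> real^2" where
  "vec_of_complex w = (\<chi> i. if i = 1 then Re w else Im w)"

definition complex_of_vec :: "real^2 \<Rightarrow> complex" where
  "complex_of_vec v = Complex (v $ 1) (v $ 2)"

lemma complex_of_vec_of_complex [simp]: "complex_of_vec (vec_of_complex w) = w"
  by (simp add: complex_of_vec_def vec_of_complex_def)

lemma vec_of_complex_of_vec [simp]: "vec_of_complex (complex_of_vec v) = v"
  by (simp add: complex_of_vec_def vec_of_complex_def vec_eq_iff forall_2)

lemma linear_vec_of_complex: "linear vec_of_complex"
  by (auto simp: linear_iff vec_of_complex_def vec_eq_iff forall_2)

lemma linear_complex_of_vec: "linear complex_of_vec"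
  by (auto simp: linear_iff complex_of_vec_def complex_eq_iff)

lemma norm_complex_of_vec [simp]: "norm (complex_of_vec v) = norm v"
  by (simp add: complex_of_vec_def norm_vec_def L2_set_def sum_2 cmod_def)

lemma vec_of_complex_box: "vec_of_complex ` box p q = box (vec_of_complex p) (vec_of_complex q)"
proof -
  have "v \<in> box (vec_of_complex p) (vec_of_complex q) \<longleftrightarrow> complex_of_vec v \<in> box p q" for v
    by (auto simp: mem_box_cart forall_2 complex_of_vec_def vec_of_complex_def in_box_complex_iff)
  moreover have "v \<in> vec_of_complex ` box p q \<longleftrightarrow> complex_of_vec v \<in> box p q" for v
    using imageI[of "complex_of_vec v" "box p q" vec_of_complex] by fastforce
  ultimately show ?thesis
    by (intro set_eqI) simp
qed

text \<open>Used twice: \<open>b = 0\<close> gives the Jacobian of a conformal map,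
  \<open>a = 1\<close> the factor by which \<open>w + b * cnj w\<close> scales area.\<close>

lemma det_matrix_complex:
  "det (matrix (\<lambda>v. vec_of_complex (a * complex_of_vec v + b * cnj (complex_of_vec v))))
     = (cmod a)\<^sup>2 - (cmod b)\<^sup>2"
  unfolding cmod_power2
  by (simp add: det_2 matrix_def axis_def vec_of_complex_def complex_of_vec_def
      algebra_simps power2_eq_square)

text \<open>Fubini for a rectangle: the integral over \<open>real^2\<close> is carried to
  \<open>real \<times> real\<close> by an area-preserving change of coordinates and iterated
  there.\<close>

lemma integral_vec_of_complex_cbox:
  fixes f :: "complex \<Rightarrow> real"
  assumes "continuous_on (cbox p q) f"
  shows "((\<lambda>v. f (complex_of_vec v)) has_integral
           integral {Re p..Re q} (\<lambda>x. integral {Im p..Im q} (\<lambda>y. f (Complex x y))))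
          (cbox (vec_of_complex p) (vec_of_complex q))"
proof -
  define F where "F = (\<lambda>(x, y). f (Complex x y))"
  define g where "g = (\<lambda>v::real^2. (v $ 1, v $ 2))"
  define h where "h = (\<lambda>(x, y). (\<chi> i. if i = 1 then x else y) :: real^2)"
  have g_box: "g ` cbox u v = cbox (g u) (g v)" for u v
  proof -
    have "z \<in> cbox (g u) (g v) \<Longrightarrow> z \<in> g ` cbox u v" for z
      by (rule image_eqI[of _ _ "h z"])
         (auto simp: g_def h_def mem_box_cart forall_2 cbox_Pair_eq split: prod.splits)
    then show ?thesis
      by (auto simp: g_def mem_box_cart forall_2 cbox_Pair_eq)
  qed
  have h_box': "h ` cbox (a, b) (c, d) = cbox (h (a, b)) (h (c, d))" for a b c d
  proof -
    have "z \<in> cbox (h (a, b)) (h (c, d)) \<Longrightarrow> z \<in> h ` cbox (a, b) (c, d)" for z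
      by (rule image_eqI[of _ _ "g z"])
         (auto simp: g_def h_def mem_box_cart forall_2 cbox_Pair_eq vec_eq_iff)
    then show ?thesis
      by (auto simp: h_def mem_box_cart forall_2 cbox_Pair_eq)
  qed
  have h_box: "h ` cbox u v = cbox (h u) (h v)" for u v
    using h_box'[of "fst u" "snd u" "fst v" "snd v"] by simp
  have cont: "continuous_on (cbox (Re p, Im p) (Re q, Im q)) F"
  proof -
    have "continuous_on (cbox (Re p, Im p) (Re q, Im q)) (\<lambda>z. f (Complex (fst z) (snd z)))"
      by (rule continuous_on_compose2[OF assms])
         (auto simp: Complex_eq cbox_Pair_eq in_cbox_complex_iff intro!: continuous_intros)
    then show ?thesis by (simp add: F_def case_prod_beta)
  qed
  \<comment> \<open>The factor \<open>1 / 1\<close> is the reciprocal of the area ratio of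
    \<open>g\<close>, which is 1 because boxes keep their content.\<close>
  have "((\<lambda>v. F (g v)) has_integral (1 / 1) *\<^sub>R integral (cbox (Re p, Im p) (Re q, Im q)) F)
      (h ` cbox (Re p, Im p) (Re q, Im q))"
  proof (rule has_integral_twiddle)
    show "h (g x) = x" for x by (simp add: g_def h_def vec_eq_iff forall_2)
    show "g (h x) = x" for x by (cases x) (simp add: g_def h_def)
    show "continuous (at x) g" for x
      unfolding g_def by (intro continuous_intros)
    show "measure lborel (g ` cbox u v) = 1 * measure lborel (cbox u v)" for u v
    proof -
      have ne: "cbox u v \<noteq> {} \<longleftrightarrow> u $ 1 \<le> v $ 1 \<and> u $ 2 \<le> v $ 2"
        unfolding interval_ne_empty_cart forall_2 ..
      have "measure lborel (cbox u v)
          = (if u $ 1 \<le> v $ 1 \<and> u $ 2 \<le> v $ 2 then (v $ 1 - u $ 1) * (v $ 2 - u $ 2) else 0)"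
        unfolding content_cbox_if_cart using ne by (auto simp: UNIV_2)
      then show ?thesis
        unfolding g_box unfolding g_def content_Pair
        by (simp only: interval_cbox content_real_if) auto
    qed
    show "(F has_integral integral (cbox (Re p, Im p) (Re q, Im q)) F)
            (cbox (Re p, Im p) (Re q, Im q))"
      by (intro integrable_integral integrable_continuous cont)
    show "\<exists>w z. g ` cbox u v = cbox w z" for u v using g_box by blast
    show "\<exists>w z. h ` cbox u v = cbox w z" for u v using h_box by blast
  qed simp
  then show ?thesis
    by (simp add: h_box integral_prod_continuous[OF cont])
       (simp add: F_def g_def h_def complex_of_vec_def vec_of_complex_def)
qed

text \<open>The real Jacobian of \<open>G\<close> is |G'|^2, so the left side is the area of the
  image of the open rectangle. Assumption \<open>sub\<close> puts that image into an ellipse, the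
  real-linear image of a disc of radius \<open>R\<close>.\<close>

lemma area_conformal_image_le:
  assumes deriv: "\<And>w. w \<in> cbox p q \<Longrightarrow> (G has_field_derivative G' w) (at w)"
    and cont: "continuous_on (cbox p q) G'"
    and inj: "inj_on G (box p q)"
    and b: "cmod b < 1"
    and R: "R \<ge> 0"
    and sub: "\<And>w. w \<in> box p q \<Longrightarrow> \<exists>u\<in>ball 0 R. G w = u + b * cnj u"
  shows "integral {Re p..Re q} (\<lambda>x. integral {Im p..Im q} (\<lambda>y. (cmod (G' (Complex x y)))\<^sup>2))
          \<le> (1 - (cmod b)\<^sup>2) * (R\<^sup>2 * pi)"
proof -
  define \<Gamma> where "\<Gamma> = (\<lambda>v. vec_of_complex (G (complex_of_vec v)))"
  define \<Gamma>' where "\<Gamma>' = (\<lambda>v h. vec_of_complex (G' (complex_of_vec v) * complex_of_vec h))"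
  define A where "A = (\<lambda>v. vec_of_complex (complex_of_vec v + b * cnj (complex_of_vec v)))"
  define I where
    "I = integral {Re p..Re q} (\<lambda>x. integral {Im p..Im q} (\<lambda>y. (cmod (G' (Complex x y)))\<^sup>2))"
  let ?S = "box (vec_of_complex p) (vec_of_complex q)"
  have S_iff: "v \<in> ?S \<longleftrightarrow> complex_of_vec v \<in> box p q" for v
    unfolding vec_of_complex_box[symmetric] by (metis complex_of_vec_of_complex image_iff vec_of_complex_of_vec)
  have det: "\<bar>det (matrix (\<Gamma>' v))\<bar> = (cmod (G' (complex_of_vec v)))\<^sup>2" for v
    using det_matrix_complex[of "G' (complex_of_vec v)" 0] by (simp add: \<Gamma>'_def)
  have "((\<lambda>v. (cmod (G' (complex_of_vec v)))\<^sup>2) has_integral I)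
      (cbox (vec_of_complex p) (vec_of_complex q))"
    unfolding I_def by (intro integral_vec_of_complex_cbox continuous_intros cont)
  \<comment> \<open>The null boundary is discarded because \<open>G\<close> need only be injective
    on the open box; in the application opposite sides are identified.\<close>
  then have int: "((\<lambda>v. \<bar>det (matrix (\<Gamma>' v))\<bar>) has_integral I) ?S"
    by (simp add: det has_integral_open_interval)
  have inj': "inj_on \<Gamma> ?S"
    by (rule inj_onI) (metis S_iff \<Gamma>_def complex_of_vec_of_complex inj inj_on_eq_iff vec_of_complex_of_vec)
  have der: "(\<Gamma> has_derivative \<Gamma>' v) (at v within ?S)" if "v \<in> ?S" for v
  proof -
    have "complex_of_vec v \<in> cbox p q"
      using that S_iff box_subset_cbox by blast
    then have "(G has_derivative (*) (G' (complex_of_vec v))) (at (complex_of_vec v))"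
      using deriv by (simp add: has_field_derivative_def)
    then have "((\<lambda>v. G (complex_of_vec v)) has_derivative (\<lambda>h. G' (complex_of_vec v) * complex_of_vec h)) (at v within ?S)"
      using has_derivative_compose linear_imp_has_derivative[OF linear_complex_of_vec] by blast
    then show ?thesis
      unfolding \<Gamma>_def \<Gamma>'_def
      using has_derivative_compose linear_imp_has_derivative[OF linear_vec_of_complex] by blast
  qed
  have m: "\<Gamma> ` ?S \<in> lmeasurable \<and> measure lebesgue (\<Gamma> ` ?S) = I"
    using has_measure_differentiable_image[OF _ der inj', of I] int by auto
  have linA: "linear A"
    unfolding A_def linear_iff by (auto simp: vec_of_complex_def complex_of_vec_def vec_eq_iff forall_2 algebra_simps)
  have "\<bar>det (matrix A)\<bar> = 1 - (cmod b)\<^sup>2"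
    using det_matrix_complex[of 1 b] b by (simp add: A_def abs_square_le_1 power_le_one_iff)
  then have mA: "measure lebesgue (A ` ball 0 R) = (1 - (cmod b)\<^sup>2) * (R\<^sup>2 * pi)"
    using measure_linear_image[OF linA, of "ball 0 R"] circle_area[OF R, of 0]
    by (simp add: measure_completion)
  have "\<Gamma> ` ?S \<subseteq> A ` ball 0 R"
  proof safe
    fix v assume "v \<in> ?S"
    then obtain u where u: "u \<in> ball 0 R" "G (complex_of_vec v) = u + b * cnj u"
      using sub S_iff by blast
    then have "\<Gamma> v = A (vec_of_complex u)"
      by (simp add: \<Gamma>_def A_def)
    moreover have "vec_of_complex u \<in> ball 0 R"
      using u norm_complex_of_vec[of "vec_of_complex u"] by simp
    ultimately show "\<Gamma> v \<in> A ` ball 0 R" by blast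
  qed
  then have "measure lebesgue (\<Gamma> ` ?S) \<le> measure lebesgue (A ` ball 0 R)"
    using m by (intro measure_mono_fmeasurable measurable_linear_image[OF linA]) (auto intro: fmeasurableD)
  then show ?thesis using m mA I_def by simp
qed

subsection \<open>The area theorem\<close>

text \<open>Cauchy's formula at the centre: the derivative of the circle path is 2 pi i times its
  position, which cancels the kernel.\<close>

lemma has_integral_circle_mean:
  assumes "F holomorphic_on ball 0 1" "0 < R" "R < 1"
  shows "((\<lambda>t. F (circlepath 0 R t)) has_integral F 0) {0..1}"
proof -
  have "((\<lambda>u. F u / (u - 0)) has_contour_integral 2 * of_real pi * \<i> * F 0) (circlepath 0 R)"
    using assms by (intro Cauchy_integral_circlepath_simple holomorphic_on_subset[OF assms(1)]) auto
  then have "((\<lambda>t. F (circlepath 0 R t) / circlepath 0 R t * vector_derivative (circlepath 0 R) (at t within {0..1}))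
      has_integral 2 * of_real pi * \<i> * F 0) {0..1}"
    by (simp add: has_contour_integral_def)
  moreover have "F (circlepath 0 R t) / circlepath 0 R t * vector_derivative (circlepath 0 R) (at t within {0..1})
      = 2 * of_real pi * \<i> * F (circlepath 0 R t)" if "t \<in> {0..1}" for t
    using that assms by (simp add: vector_derivative_circlepath01) (simp add: circlepath)
  ultimately have "((\<lambda>t. 2 * of_real pi * \<i> * F (circlepath 0 R t)) has_integral 2 * of_real pi * \<i> * F 0) {0..1}"
    by (rule has_integral_eq[rotated])
  then have "((\<lambda>t. (1 / (2 * of_real pi * \<i>)) * (2 * of_real pi * \<i> * F (circlepath 0 R t)))
      has_integral (1 / (2 * of_real pi * \<i>)) * (2 * of_real pi * \<i> * F 0)) {0..1}"
    by (rule has_integral_mult_right)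
  then show ?thesis by simp
qed

text \<open>After expanding the square, the only term discarded is |e|^2 |q - b|^2. What remains
  under \<open>Re\<close> is holomorphic in \<open>e\<close> on a circle of fixed |e| when
  \<open>q\<close> is a holomorphic function of \<open>e\<close>, since 1/e = cnj e / |e|^2
  there.\<close>

lemma norm_diff_power2_ge:
  fixes e q b :: complex
  assumes "e \<noteq> 0"
  shows "(cmod (e * q - 1 / e))\<^sup>2 \<ge> 1 / (cmod e)\<^sup>2 + (cmod b)\<^sup>2 * (cmod e)\<^sup>2
     + Re (2 * of_real ((cmod e)\<^sup>2) * cnj b * (q - b) - 2 / of_real ((cmod e)\<^sup>2) * (e\<^sup>2 * q))"
proof -
  have e: "1 / e = cnj e / of_real ((cmod e)\<^sup>2)"
    unfolding complex_norm_square using assms by simp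
  have expand: "(cmod (x - y))\<^sup>2 = (cmod x)\<^sup>2 + (cmod y)\<^sup>2 - 2 * Re (x * cnj y)" for x y
    unfolding cmod_power2 by (simp add: power2_eq_square algebra_simps)
  have "(cmod (e * q - 1 / e))\<^sup>2
      = (cmod (e * q))\<^sup>2 + (cmod (1 / e))\<^sup>2 - 2 * Re (e * q * cnj (1 / e))"
    by (rule expand)
  also have "e * q * cnj (1 / e) = (e\<^sup>2 * q) / of_real ((cmod e)\<^sup>2)"
    unfolding e by (simp add: power2_eq_square)
  finally have 1: "(cmod (e * q - 1 / e))\<^sup>2 = (cmod e)\<^sup>2 * (cmod q)\<^sup>2 + 1 / (cmod e)\<^sup>2
      - Re (2 / of_real ((cmod e)\<^sup>2) * (e\<^sup>2 * q))"
    by (simp add: norm_mult norm_divide power_mult_distrib power_divide)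
  have "(cmod q)\<^sup>2 - 2 * Re (cnj b * q) + (cmod b)\<^sup>2 = (cmod (q - b))\<^sup>2"
    unfolding expand by (simp add: mult.commute)
  then have "(cmod q)\<^sup>2 - 2 * Re (cnj b * q) + (cmod b)\<^sup>2 \<ge> 0" by simp
  then have "(cmod e)\<^sup>2 * ((cmod q)\<^sup>2 - 2 * Re (cnj b * q) + (cmod b)\<^sup>2) \<ge> 0"
    by (rule mult_nonneg_nonneg[rotated]) simp
  moreover have "Re (2 * of_real ((cmod e)\<^sup>2) * cnj b * (q - b))
      = 2 * (cmod e)\<^sup>2 * (Re (cnj b * q) - (cmod b)\<^sup>2)"
    unfolding cmod_power2 by (simp add: power2_eq_square algebra_simps)
  ultimately show ?thesis unfolding 1 by (simp add: algebra_simps)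
qed

text \<open>In the coordinate \<open>z = exp (2 \<pi> w)\<close> the annulus becomes a rectangle. The lower bound for the squared
  derivative is, on every circle, a constant plus the real part of a holomorphic function vanishing
  at 0, so that its integral is explicit.\<close>

lemma annulus_area_inequality:
  assumes holo: "p holomorphic_on ball 0 1"
    and inj: "inj_on (\<lambda>z. 1 / z + p z) (ball 0 1 - {0})"
    and \<rho>: "0 < \<rho>" "\<rho> < r" "r < 1"
    and c: "cmod c < 1" and R: "R \<ge> 0"
    and sub: "\<And>z. \<rho> < cmod z \<Longrightarrow> cmod z < r \<Longrightarrow> \<exists>u\<in>ball 0 R. 1 / z + p z = u + c * cnj u"
  shows "1 / \<rho>\<^sup>2 - 1 / r\<^sup>2 + (cmod (deriv p 0))\<^sup>2 * (r\<^sup>2 - \<rho>\<^sup>2) \<le> (1 - (cmod c)\<^sup>2) * R\<^sup>2"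
proof -
  \<comment> \<open>The vertical sides Re w = \<alpha> and Re w = \<beta> go to the circles of
    radius \<rho> and \<open>r\<close>; the height 1 of the rectangle is one period of
    \<open>e\<close>.\<close>
  define \<alpha> where "\<alpha> = ln \<rho> / (2 * pi)"
  define \<beta> where "\<beta> = ln r / (2 * pi)"
  define b where "b = deriv p 0"
  define e where "e = (\<lambda>w::complex. exp (2 * of_real pi * w))"
  define G where "G = (\<lambda>w. 1 / e w + p (e w))"
  define G' where "G' = (\<lambda>w. 2 * of_real pi * (e w * deriv p (e w) - 1 / e w))"
  define X where "X = (\<lambda>x. exp (2 * pi * x))"
  define P where "P = Complex \<alpha> 0"
  define Q where "Q = Complex \<beta> 1"
  have \<alpha>\<beta>: "\<alpha> < \<beta>" using \<rho> by (simp add: \<alpha>_def \<beta>_def divide_strict_right_mono)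
  have X\<alpha>: "X \<alpha> = \<rho>" and X\<beta>: "X \<beta> = r" using \<rho> by (auto simp: X_def \<alpha>_def \<beta>_def)
  have norm_e: "cmod (e w) = X (Re w)" for w by (simp add: e_def X_def norm_exp_eq_Re)
  have [simp]: "e w \<noteq> 0" for w by (simp add: e_def)
  have X_mono: "X x \<le> X y \<longleftrightarrow> x \<le> y" "X x < X y \<longleftrightarrow> x < y" for x y by (auto simp: X_def)
  have X_pos: "X x > 0" for x by (simp add: X_def)
  have X_lt: "X x < 1" if "x \<le> \<beta>" for x
    using X_mono(1)[of x \<beta>] that X\<beta> \<rho> by linarith
  have e_ball: "e w \<in> ball 0 1" if "w \<in> cbox P Q" for w
    using that X_lt by (auto simp: norm_e in_cbox_complex_iff P_def Q_def)
  have e_circle: "e (Complex x y) = circlepath 0 (X x) y" for x y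
    by (simp add: e_def circlepath X_def Complex_eq distrib_left exp_add flip: exp_of_real)
       (simp add: mult_ac)
  have holo': "deriv p holomorphic_on ball 0 1"
    using holo holomorphic_deriv by blast
  have e_deriv: "(e has_field_derivative 2 * of_real pi * e w) (at w)" for w
    unfolding e_def by (auto intro!: derivative_eq_intros)
  have cont_e: "continuous_on S e" for S
    unfolding e_def by (intro continuous_intros)
  have cont: "continuous_on (cbox P Q) G'"
    unfolding G'_def using e_ball
    by (intro continuous_intros cont_e continuous_on_compose2[OF holomorphic_on_imp_continuous_on[OF holo']]) auto
  have "integral {Re P..Re Q} (\<lambda>x. integral {Im P..Im Q} (\<lambda>y. (cmod (G' (Complex x y)))\<^sup>2))
      \<le> (1 - (cmod c)\<^sup>2) * (R\<^sup>2 * pi)"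
  proof (rule area_conformal_image_le[OF _ cont _ c R])
    fix w assume w: "w \<in> cbox P Q"
    have "(p has_field_derivative deriv p (e w)) (at (e w))"
      using holo e_ball[OF w] by (simp add: holomorphic_derivI)
    then have "((\<lambda>w. p (e w)) has_field_derivative deriv p (e w) * (2 * of_real pi * e w)) (at w)"
      using DERIV_chain2 e_deriv by blast
    moreover have "((\<lambda>w. 1 / e w) has_field_derivative - (2 * of_real pi) / e w) (at w)"
      by (rule derivative_eq_intros e_deriv refl | simp)+
    ultimately show "(G has_field_derivative G' w) (at w)"
      unfolding G_def G'_def using DERIV_add by (fastforce simp: algebra_simps)
  next
    show "inj_on G (box P Q)"
    proof (rule inj_onI)
      fix w v assume w: "w \<in> box P Q" and v: "v \<in> box P Q" and eq: "G w = G v"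
      then have "e w \<in> ball 0 1 - {0}" "e v \<in> ball 0 1 - {0}"
        using e_ball box_subset_cbox by (metis (no_types, lifting) Diff_iff \<open>\<And>w. e w \<noteq> 0\<close> singletonD subsetD)+
      moreover have "1 / e w + p (e w) = 1 / e v + p (e v)"
        using eq unfolding G_def .
      ultimately have "e w = e v"
        using inj_onD[OF inj] by blast
      \<comment> \<open>Two points of the open rectangle differ vertically by less than a period, so
        equal values of \<open>e\<close> force equal points.\<close>
      moreover have "\<bar>Im w - Im v\<bar> < 1"
        using w v by (auto simp: in_box_complex_iff P_def Q_def)
      then have "2 * pi * \<bar>Im w - Im v\<bar> < 2 * pi * 1"
        by (intro mult_strict_left_mono) auto
      then have "\<bar>Im (2 * of_real pi * w) - Im (2 * of_real pi * v)\<bar> < 2 * pi"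
        by (simp add: abs_mult flip: right_diff_distrib)
      ultimately have "2 * of_real pi * w = 2 * of_real pi * v"
        unfolding e_def by (rule exp_complex_eqI[rotated])
      then show "w = v" by simp
    qed
  next
    fix w assume "w \<in> box P Q"
    then have "\<rho> < cmod (e w)" "cmod (e w) < r"
      by (auto simp: norm_e X\<alpha>[symmetric] X\<beta>[symmetric] X_mono in_box_complex_iff P_def Q_def)
    then show "\<exists>u\<in>ball 0 R. G w = u + c * cnj u"
      using sub by (simp add: G_def)
  qed
  then have upper: "integral {\<alpha>..\<beta>} (\<lambda>x. integral {0..1} (\<lambda>y. (cmod (G' (Complex x y)))\<^sup>2))
      \<le> (1 - (cmod c)\<^sup>2) * (R\<^sup>2 * pi)"
    by (simp add: P_def Q_def)
  have cont2: "continuous_on ({\<alpha>..\<beta>} \<times> cbox 0 1) (\<lambda>(x, y). (cmod (G' (Complex x y)))\<^sup>2)"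
    unfolding case_prod_beta
    by (intro continuous_intros continuous_on_compose2[OF cont])
       (auto simp: Complex_eq in_cbox_complex_iff P_def Q_def intro!: continuous_intros)
  have cont_inner: "continuous_on {\<alpha>..\<beta>} (\<lambda>x. integral {0..1} (\<lambda>y. (cmod (G' (Complex x y)))\<^sup>2))"
    using integral_continuous_on_param[OF cont2] by simp
  have inner: "4 * pi\<^sup>2 * (1 / (X x)\<^sup>2 + (cmod b)\<^sup>2 * (X x)\<^sup>2)
      \<le> integral {0..1} (\<lambda>y. (cmod (G' (Complex x y)))\<^sup>2)" if x: "x \<in> {\<alpha>..\<beta>}" for x
  proof -
    define F where "F = (\<lambda>z. 2 * of_real ((X x)\<^sup>2) * cnj b * (deriv p z - b)
        - 2 / of_real ((X x)\<^sup>2) * (z\<^sup>2 * deriv p z))"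
    have "((\<lambda>t. F (circlepath 0 (X x) t)) has_integral F 0) {0..1}"
      using x by (intro has_integral_circle_mean X_pos X_lt) (auto simp: F_def intro!: holomorphic_intros holo')
    then have "((\<lambda>t. Re (F (e (Complex x t)))) has_integral Re (F 0)) {0..1}"
      unfolding e_circle by (rule has_integral_linear[OF _ bounded_linear_Re, unfolded o_def])
    moreover have "F 0 = 0" by (simp add: F_def b_def)
    ultimately have "((\<lambda>t. Re (F (e (Complex x t)))) has_integral 0) {0..1}" by simp
    moreover have const: "((\<lambda>t::real. k) has_integral k) {0..1}" for k :: real
      using has_integral_const_real[of k 0 1] by simp
    ultimately have "((\<lambda>t. 4 * pi\<^sup>2 * (1 / (X x)\<^sup>2 + (cmod b)\<^sup>2 * (X x)\<^sup>2 + Re (F (e (Complex x t)))))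
        has_integral 4 * pi\<^sup>2 * (1 / (X x)\<^sup>2 + (cmod b)\<^sup>2 * (X x)\<^sup>2 + 0)) {0..1}"
      by (intro has_integral_mult_right has_integral_add[OF const])
    moreover have "((\<lambda>y. (cmod (G' (Complex x y)))\<^sup>2) has_integral
        integral {0..1} (\<lambda>y. (cmod (G' (Complex x y)))\<^sup>2)) {0..1}"
    proof (intro integrable_integral integrable_continuous_real)
      show "continuous_on {0..1} (\<lambda>y. (cmod (G' (Complex x y)))\<^sup>2)"
        using x by (intro continuous_intros continuous_on_compose2[OF cont])
         (auto simp: Complex_eq in_cbox_complex_iff P_def Q_def intro!: continuous_intros)
    qed
    ultimately have "4 * pi\<^sup>2 * (1 / (X x)\<^sup>2 + (cmod b)\<^sup>2 * (X x)\<^sup>2 + 0)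
        \<le> integral {0..1} (\<lambda>y. (cmod (G' (Complex x y)))\<^sup>2)"
    proof (rule has_integral_le)
      fix y
      have "1 / (X x)\<^sup>2 + (cmod b)\<^sup>2 * (X x)\<^sup>2 + Re (F (e (Complex x y)))
          \<le> (cmod (e (Complex x y) * deriv p (e (Complex x y)) - 1 / e (Complex x y)))\<^sup>2"
        using norm_diff_power2_ge[of "e (Complex x y)" b "deriv p (e (Complex x y))"]
        by (simp add: norm_e F_def)
      then show "4 * pi\<^sup>2 * (1 / (X x)\<^sup>2 + (cmod b)\<^sup>2 * (X x)\<^sup>2 + Re (F (e (Complex x y))))
          \<le> (cmod (G' (Complex x y)))\<^sup>2"
        by (simp add: G'_def norm_mult power_mult_distrib)
    qed
    then show ?thesis by simp
  qed
  \<comment> \<open>An antiderivative of the lower bound for the inner integral;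
    \<open>A \<beta> - A \<alpha>\<close> is pi times the left side of the claim.\<close>
  define A where "A = (\<lambda>x. pi * ((cmod b)\<^sup>2 * (X x)\<^sup>2 - 1 / (X x)\<^sup>2))"
  have "((\<lambda>x. 4 * pi\<^sup>2 * (1 / (X x)\<^sup>2 + (cmod b)\<^sup>2 * (X x)\<^sup>2)) has_integral A \<beta> - A \<alpha>) {\<alpha>..\<beta>}"
  proof (rule fundamental_theorem_of_calculus)
    show "\<alpha> \<le> \<beta>" using \<alpha>\<beta> by simp
    fix x
    have X': "(X has_real_derivative 2 * pi * X x) (at x within {\<alpha>..\<beta>})"
      unfolding X_def by (auto intro!: derivative_eq_intros)
    have "(A has_real_derivative pi * ((cmod b)\<^sup>2 * (2 * X x * (2 * pi * X x))
        - (- (2 * X x * (2 * pi * X x)) / ((X x)\<^sup>2)\<^sup>2))) (at x within {\<alpha>..\<beta>})"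
      unfolding A_def using X_pos[of x]
      by (auto intro!: derivative_eq_intros X' simp: power2_eq_square)
    also have "pi * ((cmod b)\<^sup>2 * (2 * X x * (2 * pi * X x))
        - (- (2 * X x * (2 * pi * X x)) / ((X x)\<^sup>2)\<^sup>2)) = 4 * pi\<^sup>2 * (1 / (X x)\<^sup>2 + (cmod b)\<^sup>2 * (X x)\<^sup>2)"
      using X_pos[of x] by (simp add: field_simps power2_eq_square)
    finally show "(A has_vector_derivative 4 * pi\<^sup>2 * (1 / (X x)\<^sup>2 + (cmod b)\<^sup>2 * (X x)\<^sup>2)) (at x within {\<alpha>..\<beta>})"
      by (simp add: has_real_derivative_iff_has_vector_derivative)
  qed
  then have "A \<beta> - A \<alpha> \<le> integral {\<alpha>..\<beta>} (\<lambda>x. integral {0..1} (\<lambda>y. (cmod (G' (Complex x y)))\<^sup>2))"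
    by (rule has_integral_le[OF _ integrable_integral[OF integrable_continuous_real[OF cont_inner]]])
       (use inner in auto)
  with upper have "A \<beta> - A \<alpha> \<le> (1 - (cmod c)\<^sup>2) * (R\<^sup>2 * pi)" by linarith
  then have "pi * (1 / \<rho>\<^sup>2 - 1 / r\<^sup>2 + (cmod b)\<^sup>2 * (r\<^sup>2 - \<rho>\<^sup>2)) \<le> pi * ((1 - (cmod c)\<^sup>2) * R\<^sup>2)"
    by (simp add: A_def X\<alpha> X\<beta> algebra_simps)
  then show ?thesis by (simp add: b_def)
qed

text \<open>The quotient is the preimage of \<open>v\<close> under u + c cnj u. Its norm is at most
  (1 + |c|)/(1 - |c|^2) = 1/(1 - |c|) times |v|, and 1/(1 - |c|) is at most 2.\<close>

lemma real_affine_inverse_bound: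
  fixes c v :: complex
  assumes c: "cmod c \<le> 1 / 2"
  shows "cmod ((v - c * cnj v) / of_real (1 - (cmod c)\<^sup>2)) \<le> 2 * cmod v"
proof -
  have pos: "1 - (cmod c)\<^sup>2 > 0"
    using power_mono[OF c, of 2] by (simp add: power2_eq_square)
  have "cmod (v - c * cnj v) \<le> cmod v + cmod c * cmod v"
    using norm_triangle_ineq4[of v "c * cnj v"] by (simp add: norm_mult)
  also have "\<dots> \<le> (1 - (cmod c)\<^sup>2) * (2 * cmod v)"
  proof -
    have "(1 + cmod c) * (1 - 2 * cmod c) * cmod v \<ge> 0"
      using c by (intro mult_nonneg_nonneg) auto
    then show ?thesis by (simp add: algebra_simps power2_eq_square)
  qed
  finally show ?thesis
    using pos unfolding norm_divide norm_of_real by (simp add: pos_divide_le_eq mult.commute)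
qed

text \<open>On the inner circle \<open>b z = b \<rho>\<^sup>2 cnj (1/z)\<close>, so the image of that circle is nearly the ellipse. With \<open>T\<close>
  the inverse of the real-linear map, every real functional of \<open>T w\<close> has the form \<open>Re (m w)\<close>, hence the
  maximum principle applies to it.\<close>

lemma annulus_image_in_ellipse:
  assumes holo: "p holomorphic_on ball 0 1"
    and \<rho>: "0 < \<rho>" "\<rho> < r" "r < 1"
    and c: "cmod (b * of_real (\<rho>\<^sup>2)) \<le> 1 / 2"
    and inner: "\<And>z. cmod z = \<rho> \<Longrightarrow> cmod (p z - b * z) \<le> \<epsilon>"
    and outer: "\<And>z. cmod z = r \<Longrightarrow> 2 * cmod (1 / z + p z) \<le> 1 / \<rho>"
    and \<epsilon>: "0 < \<epsilon>"
    and z: "\<rho> < cmod z" "cmod z < r"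
  shows "\<exists>u\<in>ball 0 (1 / \<rho> + 3 * \<epsilon>). 1 / z + p z = u + (b * of_real (\<rho>\<^sup>2)) * cnj u"
proof -
  define c where "c = b * of_real (\<rho>\<^sup>2)"
  define d where "d = 1 - (cmod c)\<^sup>2"
  define T where "T = (\<lambda>w. (w - c * cnj w) / of_real d)"
  have c_le: "cmod c \<le> 1 / 2" using c by (simp add: c_def)
  have d: "d > 0"
    using power_mono[OF c_le, of 2] by (simp add: power2_eq_square d_def)
  have T_le: "cmod (T v) \<le> 2 * cmod v" for v
    unfolding T_def d_def by (rule real_affine_inverse_bound[OF c_le])
  have T_add: "T (v + w) = T v + T w" for v w
    by (simp add: T_def add_divide_distrib diff_divide_distrib algebra_simps)
  have d': "of_real d = 1 - c * cnj c" by (simp add: d_def complex_norm_square flip: of_real_power)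
  have inv1: "T w + c * cnj (T w) = w" for w
  proof -
    have "T w + c * cnj (T w) = (w * of_real d) / of_real d"
      unfolding T_def by (simp add: add_divide_distrib[symmetric] d' algebra_simps)
    then show ?thesis using d by simp
  qed
  have inv2: "T (u + c * cnj u) = u" for u
  proof -
    have "T (u + c * cnj u) = (u * of_real d) / of_real d"
      unfolding T_def by (simp add: d' algebra_simps)
    then show ?thesis using d by simp
  qed
  define u where "u = T (1 / z + p z)"
  have "cmod u \<le> 1 / \<rho> + 2 * \<epsilon>"
  proof (cases "u = 0")
    case True
    then show ?thesis using \<rho> \<epsilon> by simp
  next
    case False
    \<comment> \<open>The rotation \<open>l\<close> makes \<open>l * u\<close> equal to |u|. Since
      Re (l c cnj w) = Re (cnj (l c) w), the functional Re (l T w) is Re (m w), the real part of a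
      holomorphic function of \<open>w\<close>.\<close>
    define l where "l = cnj u / of_real (cmod u)"
    define m where "m = (l - cnj (l * c)) / of_real d"
    have l: "cmod l = 1" using False by (simp add: l_def norm_divide)
    have lu: "Re (l * u) = cmod u"
      using False by (simp add: l_def complex_norm_square[symmetric] mult.commute power2_eq_square)
    have m: "Re (m * w) = Re (l * T w)" for w
      unfolding m_def T_def using d by (simp add: field_simps)
    have Re_le: "Re (m * w) \<le> cmod (T w)" for w
      unfolding m using complex_Re_le_cmod[of "l * T w"] l by (simp add: norm_mult)
    let ?S = "ball 0 r - cball 0 \<rho> :: complex set"
    have cl: "closure ?S \<subseteq> cball 0 r - ball 0 \<rho>"
      by (rule closure_minimal) (auto intro: closed_Diff)
    have S: "open ?S" by (auto intro: open_Diff)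
    have holo': "(\<lambda>z. m * (1 / z + p z)) holomorphic_on (ball 0 1 - {0})"
      by (intro holomorphic_intros holomorphic_on_subset[OF holo]) auto
    have "Re (m * (1 / z + p z)) \<le> 1 / \<rho> + 2 * \<epsilon>"
    proof (rule maximum_real_frontier[of "\<lambda>z. m * (1 / z + p z)" ?S])
      show "(\<lambda>z. m * (1 / z + p z)) holomorphic_on interior ?S"
        by (rule holomorphic_on_subset[OF holo']) (use S \<rho> interior_open[OF S] in auto)
      show "continuous_on (closure ?S) (\<lambda>z. m * (1 / z + p z))"
        by (rule holomorphic_on_imp_continuous_on, rule holomorphic_on_subset[OF holo'])
           (use cl \<rho> in force)
      show "bounded ?S" by (simp add: bounded_diff)
      show "z \<in> ?S" using z by simp
      fix y assume "y \<in> frontier ?S"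
      then have "y \<in> cball 0 r - ball 0 \<rho>" "y \<notin> ?S"
        using cl S by (auto simp: frontier_def interior_open)
      then consider "cmod y = r" | "cmod y = \<rho>" by force
      then show "Re (m * (1 / y + p y)) \<le> 1 / \<rho> + 2 * \<epsilon>"
      proof cases
        case 1
        \<comment> \<open>On the outer circle the crude bound |T v| <= 2 |v| suffices, because
          1/\<rho> dominates everything of fixed size.\<close>
        then show ?thesis
          using outer[of y] Re_le[of "1 / y + p y"] T_le[of "1 / y + p y"] \<epsilon> by linarith
      next
        case 2
        then have y: "y \<noteq> 0" using \<rho> by auto
        have "c * cnj (1 / y) = b * y"
          using y unfolding c_def 2[symmetric] of_real_power[symmetric] complex_norm_square by simp
        then have "1 / y + p y = (1 / y + c * cnj (1 / y)) + (p y - b * y)" by simp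
        then have "T (1 / y + p y) = 1 / y + T (p y - b * y)"
          by (simp only: T_add[of "1 / y + c * cnj (1 / y)"] inv2)
        then have "cmod (T (1 / y + p y)) \<le> cmod (1 / y) + cmod (T (p y - b * y))"
          by (metis norm_triangle_ineq)
        then show ?thesis
          using Re_le[of "1 / y + p y"] T_le[of "p y - b * y"] inner[OF 2] 2
          by (simp add: norm_divide)
      qed
    qed
    then show ?thesis using lu m[of "1 / z + p z"] by (simp add: u_def)
  qed
  \<comment> \<open>The maximum principle gives only a weak inequality with 2 \<epsilon>; the third
    \<epsilon> makes it strict for the open ball.\<close>
  then have "u \<in> ball 0 (1 / \<rho> + 3 * \<epsilon>)" using \<epsilon> by simp
  moreover have "1 / z + p z = u + c * cnj u" unfolding u_def inv1 ..
  ultimately show ?thesis unfolding c_def by blast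
qed

text \<open>Coefficient form of the area theorem. As \<rho> tends to 0 the terms 1/\<rho>^2 on both
  sides of the area inequality cancel and leave |b|^2 r^2 <= 1/r^2; then r tends to 1. Since
  \<open>p 0 = 0\<close>, the error on the inner circle is o(\<rho>), which keeps its product with
  1/\<rho> small.\<close>

lemma deriv_zero_le_one_of_inj:
  assumes holo: "p holomorphic_on ball 0 1" and p0: "p 0 = 0"
    and inj: "inj_on (\<lambda>z. 1 / z + p z) (ball 0 1 - {0})"
  shows "cmod (deriv p 0) \<le> 1"
proof -
  define b where "b = deriv p 0"
  have key: "(cmod b)\<^sup>2 * r\<^sup>2 \<le> 1 / r\<^sup>2" if r: "0 < r" "r < 1" for r
  proof (rule field_le_epsilon)
    fix e :: real assume "e > 0"
    \<comment> \<open>The budget 16 \<eta> is 6 \<eta> from the cross term of the squared radius, 9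
      \<eta> from its last term and \<eta> from |b|^2 \<rho>^2.\<close>
    define \<eta> where "\<eta> = min 1 (e / 16)"
    have \<eta>: "0 < \<eta>" "\<eta> \<le> 1" "16 * \<eta> \<le> e" using \<open>e > 0\<close> by (auto simp: \<eta>_def)
    have "(p has_field_derivative b) (at 0)"
      using holo holomorphic_derivI[of p "ball 0 1" 0] by (simp add: b_def)
    then have "eventually (\<lambda>y. cmod (p y - b * y) \<le> \<eta> * cmod y) (nhds 0)"
      using \<eta> unfolding has_field_derivative_def has_derivative_at_alt
      by (auto simp: p0 eventually_nhds_metric dist_norm)
    then obtain \<delta> where \<delta>: "\<delta> > 0" "\<And>y. cmod y < \<delta> \<Longrightarrow> cmod (p y - b * y) \<le> \<eta> * cmod y"
      unfolding eventually_nhds_metric by (auto simp: dist_norm)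
    have "continuous_on (sphere 0 r) (\<lambda>z. 1 / z + p z)"
      using r by (intro continuous_intros continuous_on_subset[OF holomorphic_on_imp_continuous_on[OF holo]]) auto
    then have "bounded ((\<lambda>z. 1 / z + p z) ` sphere 0 r)"
      by (intro compact_imp_bounded compact_continuous_image) auto
    then obtain M where M: "M > 0" "\<And>z. cmod z = r \<Longrightarrow> cmod (1 / z + p z) \<le> M"
      unfolding bounded_pos by auto
    \<comment> \<open>In order after \<rho> < r, the conditions give the linear approximation on the
      inner circle, a nondegenerate ellipse, the crude bound on the outer circle, and the last error
      term.\<close>
    have "eventually (\<lambda>\<rho>. 0 < \<rho> \<and> \<rho> < r \<and> \<rho> < \<delta> \<and> cmod b * \<rho>\<^sup>2 < 1 / 2 \<and> 2 * M * \<rho> < 1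
        \<and> (cmod b)\<^sup>2 * \<rho>\<^sup>2 < \<eta>) (at_right 0)"
    proof -
      have small: "eventually (\<lambda>\<rho>. k * \<rho> ^ n < l) (at_right 0)" if "0 < l" "0 < n" for k l :: real and n
      proof (rule order_tendstoD(2))
        show "((\<lambda>\<rho>. k * \<rho> ^ n) \<longlongrightarrow> k * 0 ^ n) (at_right 0)"
          by (intro tendsto_intros)
        show "k * 0 ^ n < l" using that by (cases n) auto
      qed
      show ?thesis
        using eventually_at_right_less[of 0] small[of r 1 1] small[of \<delta> 1 1] small[of "1 / 2" 2 "cmod b"]
          small[of 1 1 "2 * M"] small[of \<eta> 2 "(cmod b)\<^sup>2"] r \<delta>(1) \<eta>
        by (simp add: eventually_conj_iff)
    qed
    then obtain \<rho> where \<rho>: "0 < \<rho>" "\<rho> < r" "\<rho> < \<delta>" "cmod b * \<rho>\<^sup>2 < 1 / 2" "2 * M * \<rho> < 1"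
        "(cmod b)\<^sup>2 * \<rho>\<^sup>2 < \<eta>"
      by (auto dest!: eventually_happens)
    have c: "cmod (b * of_real (\<rho>\<^sup>2)) \<le> 1 / 2" using \<rho> by (simp add: norm_mult norm_power)
    have "1 / \<rho>\<^sup>2 - 1 / r\<^sup>2 + (cmod (deriv p 0))\<^sup>2 * (r\<^sup>2 - \<rho>\<^sup>2)
        \<le> (1 - (cmod (b * of_real (\<rho>\<^sup>2)))\<^sup>2) * (1 / \<rho> + 3 * (\<eta> * \<rho>))\<^sup>2"
    proof (rule annulus_area_inequality[OF holo inj \<open>0 < \<rho>\<close> \<open>\<rho> < r\<close> \<open>r < 1\<close>])
      fix z assume z: "\<rho> < cmod z" "cmod z < r"
      show "\<exists>u\<in>ball 0 (1 / \<rho> + 3 * (\<eta> * \<rho>)). 1 / z + p z = u + b * of_real (\<rho>\<^sup>2) * cnj u"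
      proof (rule annulus_image_in_ellipse[OF holo \<open>0 < \<rho>\<close> \<open>\<rho> < r\<close> \<open>r < 1\<close> c _ _ _ z])
        show "cmod (p z - b * z) \<le> \<eta> * \<rho>" if "cmod z = \<rho>" for z
          using \<delta>(2)[of z] that \<rho> by simp
        show "2 * cmod (1 / z + p z) \<le> 1 / \<rho>" if "cmod z = r" for z
        proof -
          have "2 * M \<le> 1 / \<rho>" using \<rho> by (simp add: field_simps)
          then show ?thesis using M(2)[OF that] by linarith
        qed
      qed (use \<eta> \<rho> in auto)
    qed (use c \<rho> \<eta> in auto)
    also have "\<dots> \<le> 1 * (1 / \<rho> + 3 * (\<eta> * \<rho>))\<^sup>2"
      by (intro mult_right_mono) auto
    also have "\<dots> = 1 / \<rho>\<^sup>2 + 6 * \<eta> + 9 * (\<eta> * \<rho>)\<^sup>2"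
      using \<rho> by (simp add: power2_eq_square field_simps)
    also have "(\<eta> * \<rho>)\<^sup>2 \<le> \<eta>"
    proof -
      have "\<eta> * \<rho> \<le> \<eta>" "\<eta> * \<rho> \<le> 1" "0 \<le> \<eta> * \<rho>" using \<eta> \<rho> r by (auto simp: mult_le_one mult_left_le)
      then show ?thesis
        using mult_mono[of "\<eta> * \<rho>" \<eta> "\<eta> * \<rho>" 1] \<eta> by (simp add: power2_eq_square)
    qed
    finally show "(cmod b)\<^sup>2 * r\<^sup>2 \<le> 1 / r\<^sup>2 + e"
      using \<rho> \<eta> by (simp add: b_def algebra_simps)
  qed
  have "cmod b * r\<^sup>2 \<le> 1" if "0 < r" "r < 1" for r :: real
  proof -
    have "(cmod b * r\<^sup>2)\<^sup>2 \<le> 1"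
      using key[OF that] that by (simp add: field_simps power2_eq_square)
    then show ?thesis by (simp add: power_le_one_iff abs_square_le_1)
  qed
  then have "eventually (\<lambda>r::real. cmod b * r\<^sup>2 \<le> 1) (at_left 1)"
    using eventually_at_left_real[of 0 1] by (auto elim: eventually_mono)
  moreover have "((\<lambda>r::real. cmod b * r\<^sup>2) \<longlongrightarrow> cmod b * 1\<^sup>2) (at_left 1)"
    by (intro tendsto_intros)
  ultimately show ?thesis
    using tendsto_upperbound[of "\<lambda>r::real. cmod b * r\<^sup>2" "cmod b * 1\<^sup>2" "at_left 1" 1] by (simp add: b_def)
qed

subsection \<open>Bieberbach's inequality and the distortion theorem\<close>

text \<open>The area theorem is applied to the reciprocal of the odd square-root transform z s(z^2),
  where s(z)^2 = \<phi>(z)/z. This reciprocal is 1/z + p(z) with p'(0) = - s'(0), while \<phi>''(0)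
  = 4 s'(0).\<close>

lemma bieberbach_second_coefficient:
  fixes \<phi> :: "complex \<Rightarrow> complex"
  assumes "\<phi> \<in> class_S"
  shows "cmod (deriv (deriv \<phi>) 0) \<le> 4"
proof -
  have holo: "\<phi> holomorphic_on ball 0 1" and inj: "inj_on \<phi> (ball 0 1)"
    and \<phi>0: "\<phi> 0 = 0" and \<phi>'0: "deriv \<phi> 0 = 1"
    using assms by (auto simp: class_S_def)
  define k where "k = (\<lambda>z. if z = 0 then deriv \<phi> 0 else (\<phi> z - \<phi> 0) / (z - 0))"
  have k_holo: "k holomorphic_on ball 0 1"
    unfolding k_def using holo by (intro pole_lemma_open) auto
  have k_nz: "k z \<noteq> 0" if "z \<in> ball 0 1" for z
    using inj_onD[OF inj, of z 0] that by (auto simp: k_def \<phi>0 \<phi>'0)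
  obtain g where g: "g holomorphic_on ball 0 1" "\<And>z. z \<in> ball 0 1 \<Longrightarrow> k z = (g z)\<^sup>2"
    using contractible_imp_holomorphic_sqrt[OF k_holo _ k_nz]
    by (metis convex_ball convex_imp_contractible)
  \<comment> \<open>Here \<open>g 0\<close> is 1 or -1; multiplying by it selects the root with
    value 1 at the origin.\<close>
  define s where "s = (\<lambda>z. g z * g 0)"
  have g0: "(g 0)\<^sup>2 = 1" using g(2)[of 0] by (simp add: k_def \<phi>'0)
  have s_holo: "s holomorphic_on ball 0 1" unfolding s_def by (intro holomorphic_intros g(1))
  have s0: "s 0 = 1" using g0 by (simp add: s_def power2_eq_square)
  have s2: "(s z)\<^sup>2 = k z" if "z \<in> ball 0 1" for z
    using g(2)[OF that] g0 by (simp add: s_def power_mult_distrib)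
  have s_nz: "s z \<noteq> 0" if "z \<in> ball 0 1" for z
    using s2[OF that] k_nz[OF that] by auto
  have \<phi>_eq: "\<phi> z = z * (s z)\<^sup>2" if "z \<in> ball 0 1" for z
    using s2[OF that] by (simp add: k_def \<phi>0)
  \<comment> \<open>The difference quotient of 1/s with its removable singularity filled, so that z
    q(z^2) = 1/(z s(z^2)) - 1/z.\<close>
  define q where "q = (\<lambda>z. if z = 0 then deriv (\<lambda>z. 1 / s z) 0 else (1 / s z - 1 / s 0) / (z - 0))"
  have q_holo: "q holomorphic_on ball 0 1"
    unfolding q_def using s_holo s_nz by (intro pole_lemma_open holomorphic_intros) auto
  define p where "p = (\<lambda>z. z * q (z\<^sup>2))"
  have sq_ball: "z\<^sup>2 \<in> ball 0 1" if "z \<in> ball 0 1" for z :: complex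
    using that by (simp add: norm_power abs_square_less_1)
  have q2_holo: "(\<lambda>z. q (z\<^sup>2)) holomorphic_on ball 0 1"
    by (rule holomorphic_on_compose_gen[OF _ q_holo, unfolded o_def, of "\<lambda>z. z\<^sup>2"])
       (use sq_ball in \<open>auto intro!: holomorphic_intros\<close>)
  have p_holo: "p holomorphic_on ball 0 1"
    unfolding p_def by (intro holomorphic_intros q2_holo)
  have p_eq: "1 / z + p z = 1 / (z * s (z\<^sup>2))" if "z \<in> ball 0 1 - {0}" for z
    using that s_nz[OF sq_ball, of z] by (simp add: p_def q_def s0 field_simps power2_eq_square)
  have "inj_on (\<lambda>z. 1 / z + p z) (ball 0 1 - {0})"
  proof (rule inj_onI)
    fix z w assume z: "z \<in> ball 0 1 - {0 :: complex}" and w: "w \<in> ball 0 1 - {0}"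
      and "1 / z + p z = 1 / w + p w"
    then have eq: "z * s (z\<^sup>2) = w * s (w\<^sup>2)"
      using s_nz[OF sq_ball, of z] s_nz[OF sq_ball, of w] by (simp add: p_eq)
    then have "(z * s (z\<^sup>2))\<^sup>2 = (w * s (w\<^sup>2))\<^sup>2" by simp
    then have "\<phi> (z\<^sup>2) = \<phi> (w\<^sup>2)"
      using \<phi>_eq[OF sq_ball, of z] \<phi>_eq[OF sq_ball, of w] z w by (simp add: power_mult_distrib)
    then have "z\<^sup>2 = w\<^sup>2"
      using inj_onD[OF inj] sq_ball[of z] sq_ball[of w] z w by blast
    \<comment> \<open>From z^2 = w^2 the factors s(z^2) and s(w^2) agree and are nonzero, so
      \<open>eq\<close> excludes z = - w for nonzero points.\<close>
    then show "z = w"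
      using eq s_nz[OF sq_ball, of w] w by simp
  qed
  then have "cmod (deriv p 0) \<le> 1"
    using deriv_zero_le_one_of_inj[OF p_holo] by (simp add: p_def)
  moreover have "deriv p 0 = - deriv s 0"
  proof -
    have "((\<lambda>z. q (z\<^sup>2)) has_field_derivative deriv (\<lambda>z. q (z\<^sup>2)) 0) (at 0)"
      using q2_holo by (auto intro: holomorphic_derivI)
    then have "(p has_field_derivative q 0) (at 0)"
      unfolding p_def by (auto intro!: derivative_eq_intros)
    moreover have "((\<lambda>z. 1 / s z) has_field_derivative - deriv s 0) (at 0)"
      using holomorphic_derivI[OF s_holo, of 0] s0 by (auto intro!: derivative_eq_intros)
    ultimately show ?thesis by (simp add: q_def DERIV_imp_deriv)
  qed
  moreover have "deriv (deriv \<phi>) 0 = 4 * deriv s 0"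
  proof -
    have s': "(s has_field_derivative deriv s z) (at z)" if "z \<in> ball 0 1" for z
      using holomorphic_derivI[OF s_holo _ that] by simp
    have "deriv \<phi> z = (s z)\<^sup>2 + z * (2 * s z * deriv s z)" if z: "z \<in> ball 0 1" for z
    proof (rule DERIV_imp_deriv)
      have "((\<lambda>z. z * (s z)\<^sup>2) has_field_derivative (s z)\<^sup>2 + z * (2 * s z * deriv s z)) (at z)"
        by (auto intro!: derivative_eq_intros s'[OF z] simp: power2_eq_square)
      then show "(\<phi> has_field_derivative (s z)\<^sup>2 + z * (2 * s z * deriv s z)) (at z)"
        by (rule has_field_derivative_transform_within_open[OF _ open_ball z]) (simp add: \<phi>_eq)
    qed
    moreover have "((\<lambda>z. (s z)\<^sup>2 + z * (2 * s z * deriv s z)) has_field_derivative 4 * deriv s 0) (at 0)"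
    proof -
      have "(deriv s has_field_derivative deriv (deriv s) 0) (at 0)"
        using holomorphic_derivI[of "deriv s" "ball 0 1" 0] holomorphic_deriv[OF s_holo] by simp
      then show ?thesis
        by (auto intro!: derivative_eq_intros s' simp: s0)
    qed
    ultimately have "(deriv \<phi> has_field_derivative 4 * deriv s 0) (at 0)"
      by (subst has_field_derivative_cong_ev[OF refl _ refl])
         (auto intro!: eventually_nhds_in_open[of "ball 0 1", THEN eventually_mono])
    then show ?thesis by (rule DERIV_imp_deriv)
  qed
  ultimately show ?thesis by (simp add: norm_mult)
qed

text \<open>The expression inside the norm is the second derivative at 0 of the Koebe transform
  \<open>\<psi>\<close> of \<open>\<phi>\<close> at \<open>a\<close>, which is again in
  \<open>class_S\<close>, so Bieberbach's inequality applies.\<close>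

lemma class_S_second_derivative_bound:
  fixes \<phi> :: "complex \<Rightarrow> complex"
  assumes \<phi>: "\<phi> \<in> class_S" and a: "a \<in> ball 0 1"
  shows "cmod ((1 - (cmod a)\<^sup>2) * (deriv (deriv \<phi>) a / deriv \<phi> a) - 2 * cnj a) \<le> 4"
proof -
  have holo: "\<phi> holomorphic_on ball 0 1" and inj: "inj_on \<phi> (ball 0 1)"
    using \<phi> by (auto simp: class_S_def)
  define d where "d = 1 - (cmod a)\<^sup>2"
  \<comment> \<open>A disc automorphism with M(0) = a and M'(0) = d; hence d A is the derivative of
    \<phi> o M at 0, and dividing by it normalises \<open>\<psi>\<close>.\<close>
  define M where "M = (\<lambda>z. (z + a) / (1 + cnj a * z))"
  define A where "A = deriv \<phi> a"
  define \<psi> where "\<psi> = (\<lambda>z. (\<phi> (M z) - \<phi> a) / (of_real d * A))"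
  have d_pos: "d > 0" using a by (simp add: d_def abs_square_less_1)
  have d_eq: "of_real d = 1 - cnj a * a"
    by (simp add: d_def complex_norm_square mult.commute flip: of_real_power)
  have A: "A \<noteq> 0"
    unfolding A_def using holomorphic_injective_imp_regular[OF holo _ inj a] by simp
  have den: "1 + cnj a * z \<noteq> 0" if "z \<in> ball 0 1" for z
  proof
    assume "1 + cnj a * z = 0"
    then have "cmod (cnj a * z) = 1" by (metis add_eq_0_iff norm_minus_cancel norm_one)
    moreover have "cmod a * cmod z < 1 * 1" using that a by (intro mult_strict_mono') auto
    ultimately show False by (simp add: norm_mult)
  qed
  have M_ball: "M z \<in> ball 0 1" if z: "z \<in> ball 0 1" for z
  proof -
    have "(cmod (1 + cnj a * z))\<^sup>2 - (cmod (z + a))\<^sup>2 = (1 - (cmod a)\<^sup>2) * (1 - (cmod z)\<^sup>2)"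
      unfolding cmod_power2 by (simp add: power2_eq_square algebra_simps)
    also have "\<dots> > 0" using z a by (intro mult_pos_pos) (auto simp: abs_square_less_1)
    finally have "cmod (z + a) < cmod (1 + cnj a * z)"
      by (simp add: power2_less_imp_less)
    then show ?thesis using den[OF z] by (simp add: M_def norm_divide)
  qed
  have M_deriv: "(M has_field_derivative of_real d / (1 + cnj a * z)\<^sup>2) (at z)"
    if z: "z \<in> ball 0 1" for z
    unfolding M_def using den[OF z]
    by (auto intro!: derivative_eq_intros simp: d_eq power2_eq_square algebra_simps)
  have inj_M: "inj_on M (ball 0 1)"
  proof (rule inj_onI)
    fix z w assume z: "z \<in> ball 0 1" and w: "w \<in> ball 0 1" and "M z = M w"
    then have "(z + a) * (1 + cnj a * w) = (w + a) * (1 + cnj a * z)"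
      using den[OF z] den[OF w] by (simp add: M_def frac_eq_eq)
    then have "of_real d * (z - w) = 0" by (simp add: d_eq algebra_simps)
    then show "z = w" using d_pos by simp
  qed
  have \<phi>': "(\<phi> has_field_derivative deriv \<phi> z) (at z)" if "z \<in> ball 0 1" for z
    using holomorphic_derivI[OF holo _ that] by simp
  have \<phi>'': "(deriv \<phi> has_field_derivative deriv (deriv \<phi>) z) (at z)" if "z \<in> ball 0 1" for z
    using holomorphic_derivI[OF holomorphic_deriv[OF holo] _ that] by simp
  have \<psi>': "(\<psi> has_field_derivative deriv \<phi> (M z) / (A * (1 + cnj a * z)\<^sup>2)) (at z)"
    if z: "z \<in> ball 0 1" for z
  proof -
    have "((\<lambda>z. \<phi> (M z)) has_field_derivative deriv \<phi> (M z) * (of_real d / (1 + cnj a * z)\<^sup>2)) (at z)"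
      by (rule DERIV_chain2[OF \<phi>'[OF M_ball[OF z]] M_deriv[OF z]])
    then show ?thesis
      unfolding \<psi>_def using d_pos A den[OF z]
      by (auto intro!: derivative_eq_intros simp: field_simps)
  qed
  have M0: "M 0 = a" by (simp add: M_def)
  have "\<psi> \<in> class_S"
    unfolding class_S_def
  proof (intro CollectI conjI)
    show "\<psi> holomorphic_on ball 0 1"
      using \<psi>' holomorphic_on_open[OF open_ball] by blast
    show "inj_on \<psi> (ball 0 1)"
    proof (rule inj_onI)
      fix z w assume z: "z \<in> ball 0 1" and w: "w \<in> ball 0 1" and "\<psi> z = \<psi> w"
      then have "\<phi> (M z) = \<phi> (M w)" using d_pos A by (simp add: \<psi>_def)
      then have "M z = M w" using inj_onD[OF inj] M_ball z w by blast
      then show "z = w" using inj_onD[OF inj_M] z w by blast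
    qed
    show "\<psi> 0 = 0" by (simp add: \<psi>_def M0)
    show "deriv \<psi> 0 = 1"
      using DERIV_imp_deriv[OF \<psi>'[of 0]] A by (simp add: M0 A_def)
  qed
  then have bound: "cmod (deriv (deriv \<psi>) 0) \<le> 4" by (rule bieberbach_second_coefficient)
  have "((\<lambda>z. deriv \<phi> (M z)) has_field_derivative deriv (deriv \<phi>) (M 0) * (of_real d / (1 + cnj a * 0)\<^sup>2)) (at 0)"
    by (rule DERIV_chain2[OF \<phi>''[OF M_ball] M_deriv]) auto
  then have "((\<lambda>z. deriv \<phi> (M z) / (A * (1 + cnj a * z)\<^sup>2)) has_field_derivative
      (deriv (deriv \<phi>) a * of_real d * A - A * (A * (2 * cnj a))) / (A * A)) (at 0)"
    using A by (auto intro!: derivative_eq_intros simp: M0 A_def[symmetric])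
  then have "(deriv \<psi> has_field_derivative
      (deriv (deriv \<phi>) a * of_real d * A - A * (A * (2 * cnj a))) / (A * A)) (at 0)"
    by (rule has_field_derivative_transform_within_open[where S = "ball 0 1"])
       (use DERIV_imp_deriv[OF \<psi>'] in auto)
  then have "deriv (deriv \<psi>) 0 = (deriv (deriv \<phi>) a * of_real d * A - A * (A * (2 * cnj a))) / (A * A)"
    by (rule DERIV_imp_deriv)
  also have "\<dots> = of_real d * (deriv (deriv \<phi>) a / deriv \<phi> a) - 2 * cnj a"
    using A by (simp add: A_def[symmetric] field_simps)
  finally show ?thesis using bound by (simp add: d_def)
qed

text \<open>Along the radius to \<open>z\<close>, the second derivative bound controls the
  derivative of ln |\<phi>'|^2 from both sides; integration gives both estimates. They are squared
  because the Jacobian contains |\<phi>'|^2.\<close>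

lemma class_S_distortion:
  fixes \<phi> :: "complex \<Rightarrow> complex"
  assumes \<phi>: "\<phi> \<in> class_S" and z: "z \<in> ball 0 1"
  shows "(1 - cmod z)\<^sup>2 / (1 + cmod z) ^ 6 \<le> (cmod (deriv \<phi> z))\<^sup>2"
    and "(cmod (deriv \<phi> z))\<^sup>2 \<le> (1 + cmod z)\<^sup>2 / (1 - cmod z) ^ 6"
proof -
  have holo: "\<phi> holomorphic_on ball 0 1" and inj: "inj_on \<phi> (ball 0 1)" and \<phi>'0: "deriv \<phi> 0 = 1"
    using \<phi> by (auto simp: class_S_def)
  define r where "r = cmod z"
  \<comment> \<open>The direction of the radius; for z = 0 any unit number would serve.\<close>
  define \<zeta> where "\<zeta> = (if z = 0 then 1 else z / of_real r)"
  have \<zeta>: "cmod \<zeta> = 1" and r\<zeta>: "of_real r * \<zeta> = z"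
    by (auto simp: \<zeta>_def r_def norm_divide)
  have r: "0 \<le> r" "r < 1" using z by (auto simp: r_def)
  define F where "F = (\<lambda>t. deriv \<phi> (of_real t * \<zeta>))"
  define D where "D = (\<lambda>t. \<zeta> * deriv (deriv \<phi>) (of_real t * \<zeta>))"
  define N where "N = (\<lambda>t. (Re (F t))\<^sup>2 + (Im (F t))\<^sup>2)"
  have N_eq: "N t = (cmod (F t))\<^sup>2" for t by (simp add: N_def cmod_power2)
  have in_ball: "of_real t * \<zeta> \<in> ball 0 1" if "0 \<le> t" "t \<le> r" for t
    using that r \<zeta> by (simp add: norm_mult)
  have F_nz: "F t \<noteq> 0" if "0 \<le> t" "t \<le> r" for t
    unfolding F_def using holomorphic_injective_imp_regular[OF holo _ inj in_ball[OF that]] by simp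
  then have N_pos: "N t > 0" if "0 \<le> t" "t \<le> r" for t
    using that by (simp add: N_eq)
  have F': "(F has_vector_derivative D t) (at t)" if t: "0 \<le> t" "t \<le> r" for t
  proof -
    have "(deriv \<phi> has_field_derivative deriv (deriv \<phi>) (of_real t * \<zeta>)) (at (of_real t * \<zeta>))"
      using holomorphic_derivI[OF holomorphic_deriv[OF holo] _ in_ball[OF t]] by simp
    moreover have "((\<lambda>t. of_real t * \<zeta>) has_vector_derivative \<zeta>) (at t)"
      by (auto intro!: derivative_eq_intros)
    ultimately show ?thesis
      unfolding F_def D_def using field_vector_diff_chain_at by (fastforce simp: o_def)
  qed
  define E where "E = (\<lambda>t. Re (D t / F t))"
  have lnN: "((\<lambda>t. ln (N t)) has_real_derivative 2 * E t) (at t)" if t: "0 \<le> t" "t \<le> r" for t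
  proof -
    have "(N has_real_derivative 2 * (Re (F t) * Re (D t) + Im (F t) * Im (D t))) (at t)"
      unfolding N_def
      by (rule derivative_eq_intros F'[OF t] refl | simp add: algebra_simps)+
    then have "((\<lambda>t. ln (N t)) has_real_derivative
        2 * (Re (F t) * Re (D t) + Im (F t) * Im (D t)) / N t) (at t)"
      using N_pos[OF t] by (auto intro!: derivative_eq_intros)
    moreover have "E t = (Re (F t) * Re (D t) + Im (F t) * Im (D t)) / N t"
      by (simp add: E_def Re_divide N_def mult.commute)
    ultimately show ?thesis by simp
  qed
  \<comment> \<open>Multiplication by the unit number \<zeta> turns the term 2 cnj a into the real
    number 2 t, so taking real parts isolates \<open>E t\<close>.\<close>
  have E_bound: "\<bar>(1 - t\<^sup>2) * E t - 2 * t\<bar> \<le> 4" if t: "0 \<le> t" "t \<le> r" for t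
  proof -
    define W where "W = deriv (deriv \<phi>) (of_real t * \<zeta>) / deriv \<phi> (of_real t * \<zeta>)"
    have "cmod (\<zeta> * ((1 - (cmod (of_real t * \<zeta>))\<^sup>2) * W - 2 * cnj (of_real t * \<zeta>))) \<le> 4"
      using class_S_second_derivative_bound[OF \<phi> in_ball[OF t]] \<zeta> by (simp add: norm_mult W_def)
    moreover have "\<zeta> * ((1 - (cmod (of_real t * \<zeta>))\<^sup>2) * W - 2 * cnj (of_real t * \<zeta>))
        = of_real (1 - t\<^sup>2) * (\<zeta> * W) - 2 * of_real t * (\<zeta> * cnj \<zeta>)"
      using \<zeta> by (simp add: norm_mult algebra_simps)
    moreover have "\<zeta> * cnj \<zeta> = 1" using \<zeta> complex_norm_square[of \<zeta>] by simp
    moreover have "\<zeta> * W = D t / F t" by (simp add: W_def D_def F_def)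
    ultimately have "cmod (of_real (1 - t\<^sup>2) * (D t / F t) - of_real (2 * t)) \<le> 4" by simp
    then have "\<bar>Re (of_real (1 - t\<^sup>2) * (D t / F t) - of_real (2 * t))\<bar> \<le> 4"
      using abs_Re_le_cmod order_trans by blast
    moreover have "Re (of_real a * w - of_real b) = a * Re w - b" for a b w by simp
    ultimately show ?thesis by (simp only: E_def)
  qed
  have N0: "N 0 = 1" by (simp add: N_eq F_def \<phi>'0)
  have Nr: "N r = (cmod (deriv \<phi> z))\<^sup>2" by (simp add: N_eq F_def r\<zeta>)
  have E_le: "2 * E t \<le> 2 / (1 + t) + 6 / (1 - t)" "2 * E t \<ge> - 2 / (1 - t) - 6 / (1 + t)"
    if t: "0 \<le> t" "t \<le> r" for t
  proof -
    have pos: "1 - t > 0" "1 + t > 0" using t r by auto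
    have sq: "1 - t\<^sup>2 = (1 - t) * (1 + t)" by (simp add: power2_eq_square algebra_simps)
    have "(1 - t) * (1 + t) * E t \<le> 4 + 2 * t" "(1 - t) * (1 + t) * E t \<ge> 2 * t - 4"
      using E_bound[OF t] unfolding sq abs_le_iff by linarith+
    then have "E t \<le> (4 + 2 * t) / ((1 - t) * (1 + t))" "E t \<ge> (2 * t - 4) / ((1 - t) * (1 + t))"
      using pos by (simp_all add: pos_le_divide_eq pos_divide_le_eq mult.commute)
    moreover have "2 / (1 + t) + 6 / (1 - t) = 2 * ((4 + 2 * t) / ((1 - t) * (1 + t)))"
      "- 2 / (1 - t) - 6 / (1 + t) = 2 * ((2 * t - 4) / ((1 - t) * (1 + t)))"
      using pos by (simp_all add: divide_simps)
    ultimately show "2 * E t \<le> 2 / (1 + t) + 6 / (1 - t)" "2 * E t \<ge> - 2 / (1 - t) - 6 / (1 + t)"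
      by linarith+
  qed
  \<comment> \<open>The subtracted function is ln ((1 + t)^2 / (1 - t)^6), whose derivative is the
    upper bound in \<open>E_le\<close>; the difference therefore decreases from its value at
    0.\<close>
  have "ln (N r) - (2 * ln (1 + r) - 6 * ln (1 - r)) \<le> ln (N 0) - (2 * ln (1 + 0) - 6 * ln (1 - 0))"
  proof (rule DERIV_nonpos_imp_nonincreasing[OF r(1), of "\<lambda>t. ln (N t) - (2 * ln (1 + t) - 6 * ln (1 - t))"])
    fix t assume t: "0 \<le> t" "t \<le> r"
    have "((\<lambda>t. 2 * ln (1 + t) - 6 * ln (1 - t)) has_real_derivative 2 / (1 + t) + 6 / (1 - t)) (at t)"
      using t r by (auto intro!: derivative_eq_intros)
    from DERIV_diff[OF lnN[OF t] this] show "\<exists>y. ((\<lambda>t. ln (N t) - (2 * ln (1 + t) - 6 * ln (1 - t))) has_real_derivative y) (at t) \<and> y \<le> 0"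
      using E_le(1)[OF t] by fastforce
  qed
  then have "ln (N r) \<le> ln ((1 + r)\<^sup>2 / (1 - r) ^ 6)"
    using r by (simp add: N0 ln_div ln_realpow)
  then have "N r \<le> (1 + r)\<^sup>2 / (1 - r) ^ 6"
    using r N_pos[of r] by (subst (asm) ln_le_cancel_iff) auto
  then show "(cmod (deriv \<phi> z))\<^sup>2 \<le> (1 + cmod z)\<^sup>2 / (1 - cmod z) ^ 6"
    using Nr by (simp add: r_def)
  have "ln (N 0) - (2 * ln (1 - 0) - 6 * ln (1 + 0)) \<le> ln (N r) - (2 * ln (1 - r) - 6 * ln (1 + r))"
  proof (rule DERIV_nonneg_imp_nondecreasing[OF r(1), of "\<lambda>t. ln (N t) - (2 * ln (1 - t) - 6 * ln (1 + t))"])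
    fix t assume t: "0 \<le> t" "t \<le> r"
    have "((\<lambda>t. 2 * ln (1 - t) - 6 * ln (1 + t)) has_real_derivative - 2 / (1 - t) - 6 / (1 + t)) (at t)"
      using t r by (auto intro!: derivative_eq_intros)
    from DERIV_diff[OF lnN[OF t] this] show "\<exists>y. ((\<lambda>t. ln (N t) - (2 * ln (1 - t) - 6 * ln (1 + t))) has_real_derivative y) (at t) \<and> 0 \<le> y"
      using E_le(2)[OF t] by fastforce
  qed
  then have "ln ((1 - r)\<^sup>2 / (1 + r) ^ 6) \<le> ln (N r)"
    using r by (simp add: N0 ln_div ln_realpow)
  then have "(1 - r)\<^sup>2 / (1 + r) ^ 6 \<le> N r"
    using r N_pos[of r] by (subst (asm) ln_le_cancel_iff) auto
  then show "(1 - cmod z)\<^sup>2 / (1 + cmod z) ^ 6 \<le> (cmod (deriv \<phi> z))\<^sup>2"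
    using Nr by (simp add: r_def)
qed

subsection \<open>Jacobians of harmonic maps\<close>

lemma canonical_decomp_has_derivative:
  assumes "canonical_decomp f h g" "z \<in> \<bbbD>"
  shows "(f has_derivative (\<lambda>v. deriv h z * v + cnj (deriv g z * v))) (at z)"
proof -
  have "(h has_derivative (*) (deriv h z)) (at z)" "(g has_derivative (*) (deriv g z)) (at z)"
    using assms holomorphic_derivI[OF _ open_ball, of _ 0 1 z UNIV]
    unfolding canonical_decomp_def has_field_derivative_def by auto
  then have "((\<lambda>z. h z + cnj (g z)) has_derivative (\<lambda>v. deriv h z * v + cnj (deriv g z * v))) (at z)"
    by (intro has_derivative_add has_derivative_cnj)
  then show ?thesis
    by (rule has_derivative_transform_within_open[OF _ open_ball assms(2)])
       (use assms in \<open>auto simp: canonical_decomp_def\<close>)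
qed

text \<open>The real derivative of \<open>f\<close> splits uniquely into a complex-linear and an
  antilinear part, separated by its values at 1 and i. This makes the Jacobian independent of the
  chosen decomposition.\<close>

lemma canonical_decomp_deriv_unique:
  assumes "canonical_decomp f h g" "canonical_decomp f h' g'" "z \<in> \<bbbD>"
  shows "deriv h z = deriv h' z" "deriv g z = deriv g' z"
proof -
  have eq: "(\<lambda>v. deriv h z * v + cnj (deriv g z * v)) = (\<lambda>v. deriv h' z * v + cnj (deriv g' z * v))"
    using has_derivative_unique canonical_decomp_has_derivative assms by blast
  from fun_cong[OF eq, of 1] fun_cong[OF eq, of \<i>]
  show "deriv h z = deriv h' z" "deriv g z = deriv g' z"
    by (auto simp: complex_eq_iff)
qed

lemma harmonic_jacobian_unique:
  assumes "canonical_decomp f h g" "canonical_decomp f h' g'" "z \<in> \<bbbD>"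
  shows "harmonic_jacobian h g z = harmonic_jacobian h' g' z"
  using canonical_decomp_deriv_unique[OF assms] by (simp add: harmonic_jacobian_def)

lemma dbar_canonical_decomp:
  assumes "canonical_decomp f h g" "z \<in> \<bbbD>"
  shows "dbar f z = cnj (deriv g z)"
  unfolding dbar_def frechet_derivative_at[OF canonical_decomp_has_derivative[OF assms], symmetric]
  by (simp add: complex_eq_iff)

text \<open>Regrouping gives f0 + c cnj f0 = (h + c g) + cnj (g + cnj c h), and 1 - |c|^2 is the
  determinant of w + c cnj w. The condition g'(0) = 0 preserves the normalisation at the origin and
  makes the derivative of the second part there cnj c.\<close>

lemma canonical_decomp_affine:
  assumes f0: "canonical_decomp f0 h g" and g0: "deriv g 0 = 0"
    and f: "\<And>z. z \<in> \<bbbD> \<Longrightarrow> f z = f0 z + c * cnj (f0 z)"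
  shows "canonical_decomp f (\<lambda>z. h z + c * g z) (\<lambda>z. g z + cnj c * h z)"
    and "z \<in> \<bbbD> \<Longrightarrow> harmonic_jacobian (\<lambda>z. h z + c * g z) (\<lambda>z. g z + cnj c * h z) z
      = (1 - (cmod c)\<^sup>2) * harmonic_jacobian h g z"
    and "dbar f 0 = c"
proof -
  have h: "(h has_field_derivative deriv h z) (at z)" and g: "(g has_field_derivative deriv g z) (at z)"
    if "z \<in> \<bbbD>" for z
    using f0 that by (auto simp: canonical_decomp_def intro: holomorphic_derivI)
  have h': "deriv (\<lambda>z. h z + c * g z) z = deriv h z + c * deriv g z"
    and g': "deriv (\<lambda>z. g z + cnj c * h z) z = deriv g z + cnj c * deriv h z" if "z \<in> \<bbbD>" for z
    by (auto intro!: DERIV_imp_deriv derivative_eq_intros h[OF that] g[OF that])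
  show *: "canonical_decomp f (\<lambda>z. h z + c * g z) (\<lambda>z. g z + cnj c * h z)"
    using f0 unfolding canonical_decomp_def
    by (auto simp: f h' g0 algebra_simps intro!: holomorphic_intros)
  have "deriv h 0 = 1" using f0 by (simp add: canonical_decomp_def)
  then show "dbar f 0 = c"
    using dbar_canonical_decomp[OF *, of 0] g'[of 0] g0 by simp
  have "(cmod (a + c * b))\<^sup>2 - (cmod (b + cnj c * a))\<^sup>2 = (1 - (cmod c)\<^sup>2) * ((cmod a)\<^sup>2 - (cmod b)\<^sup>2)" for a b
    unfolding cmod_power2 by (simp add: power2_eq_square algebra_simps)
  then show "harmonic_jacobian (\<lambda>z. h z + c * g z) (\<lambda>z. g z + cnj c * h z) z
      = (1 - (cmod c)\<^sup>2) * harmonic_jacobian h g z" if "z \<in> \<bbbD>"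
    unfolding harmonic_jacobian_def h'[OF that] g'[OF that] .
qed

text \<open>With s = |\<omega>(z)| <= r = |z|, the factor (1 - s^2)/|1 + e \<omega>|^2 lies between
  (1 - r)/(1 + r) and its reciprocal. Multiplied with the distortion bounds this produces the
  exponents 3 and 7.\<close>

lemma shear_jacobian_bounds:
  assumes h: "h holomorphic_on \<bbbD>" and g: "g holomorphic_on \<bbbD>" and g'0: "deriv g 0 = 0"
    and sense: "\<And>z. z \<in> \<bbbD> \<Longrightarrow> harmonic_jacobian h g z > 0"
    and S: "(\<lambda>z. h z + e * g z) \<in> class_S" and e: "cmod e = 1" and z: "z \<in> \<bbbD>"
  shows "(1 - cmod z) ^ 3 / (1 + cmod z) ^ 7 \<le> harmonic_jacobian h g z"
    and "harmonic_jacobian h g z \<le> (1 + cmod z) ^ 3 / (1 - cmod z) ^ 7"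
proof -
  define \<omega> where "\<omega> = (\<lambda>z. deriv g z / deriv h z)"
  have lt: "cmod (deriv g z) < cmod (deriv h z)" if "z \<in> \<bbbD>" for z
    using sense[OF that] by (auto simp: harmonic_jacobian_def intro: power2_less_imp_less)
  then have h_nz: "deriv h z \<noteq> 0" if "z \<in> \<bbbD>" for z
    using that by fastforce
  have "cmod (\<omega> z) \<le> cmod z"
  proof (rule Schwarz_Lemma(1))
    show "\<omega> holomorphic_on \<bbbD>"
      unfolding \<omega>_def using h_nz by (intro holomorphic_intros holomorphic_deriv h g) auto
    show "cmod (\<omega> y) < 1" if "cmod y < 1" for y
      using lt[of y] h_nz[of y] that by (simp add: \<omega>_def norm_divide)
  qed (use z g'0 in \<open>auto simp: \<omega>_def\<close>)
  moreover define s where "s = cmod (\<omega> z)"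
  moreover define r where "r = cmod z"
  ultimately have s: "0 \<le> s" "s \<le> r" and r: "0 \<le> r" "r < 1" using z by auto
  define q where "q = cmod (1 + e * \<omega> z)"
  define N where "N = (cmod (deriv h z))\<^sup>2"
  have q: "q \<le> 1 + s" "1 - s \<le> q" "0 \<le> q"
    using norm_triangle_ineq[of 1 "e * \<omega> z"] norm_triangle_ineq2[of 1 "- (e * \<omega> z)"] e
    by (auto simp: q_def s_def norm_mult)
  have g_eq: "deriv g z = deriv h z * \<omega> z" using h_nz[OF z] by (simp add: \<omega>_def)
  have J: "harmonic_jacobian h g z = N * (1 - s\<^sup>2)"
    by (simp add: harmonic_jacobian_def N_def g_eq s_def norm_mult power_mult_distrib algebra_simps)
  have "deriv (\<lambda>z. h z + e * g z) z = deriv h z + e * deriv g z"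
    using z by (auto intro!: DERIV_imp_deriv derivative_eq_intros holomorphic_derivI[OF h] holomorphic_derivI[OF g])
  also have "\<dots> = deriv h z * (1 + e * \<omega> z)" by (simp add: g_eq algebra_simps)
  finally have \<phi>': "(cmod (deriv (\<lambda>z. h z + e * g z) z))\<^sup>2 = N * q\<^sup>2"
    by (simp add: N_def q_def norm_mult power_mult_distrib)
  have dist: "(1 - r)\<^sup>2 / (1 + r) ^ 6 \<le> N * q\<^sup>2" "N * q\<^sup>2 \<le> (1 + r)\<^sup>2 / (1 - r) ^ 6"
    using class_S_distortion[OF S z] by (simp_all add: \<phi>' r_def)
  have N: "N \<ge> 0" by (simp add: N_def)
  \<comment> \<open>Cross-multiplied form of (1 - r)/(1 + r) <= (1 - s^2)/q^2; the added nonnegative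
    term measures how far s is below r.\<close>
  have "q\<^sup>2 * (1 - r) \<le> (1 + s)\<^sup>2 * (1 - r)"
    using q r by (intro mult_right_mono power_mono) auto
  also have "\<dots> \<le> (1 + s)\<^sup>2 * (1 - r) + (1 + s) * (2 * (r - s))"
    using s by simp
  also have "\<dots> = (1 - s\<^sup>2) * (1 + r)" by (simp add: power2_eq_square algebra_simps)
  finally have "N * (q\<^sup>2 * (1 - r)) \<le> N * ((1 - s\<^sup>2) * (1 + r))" by (rule mult_left_mono[OF _ N])
  then have "N * q\<^sup>2 * ((1 - r) / (1 + r)) \<le> harmonic_jacobian h g z"
    using r by (simp add: J divide_simps mult.assoc)
  moreover have "(1 - r)\<^sup>2 / (1 + r) ^ 6 * ((1 - r) / (1 + r)) \<le> N * q\<^sup>2 * ((1 - r) / (1 + r))"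
    using dist r by (intro mult_right_mono) auto
  moreover have "(1 - r)\<^sup>2 / (1 + r) ^ 6 * ((1 - r) / (1 + r)) = (1 - r) ^ 3 / (1 + r) ^ 7"
    by (simp add: eval_nat_numeral mult_ac)
  ultimately show "(1 - cmod z) ^ 3 / (1 + cmod z) ^ 7 \<le> harmonic_jacobian h g z"
    by (simp add: r_def)
  have "(1 - s\<^sup>2) * (1 - r) = (1 - s)\<^sup>2 * (1 + r) - (1 - s) * (2 * (r - s))"
    by (simp add: power2_eq_square algebra_simps)
  also have "\<dots> \<le> (1 - s)\<^sup>2 * (1 + r)" using s r by simp
  also have "\<dots> \<le> q\<^sup>2 * (1 + r)"
    using q s r by (intro mult_right_mono power_mono) auto
  finally have "N * ((1 - s\<^sup>2) * (1 - r)) \<le> N * (q\<^sup>2 * (1 + r))" by (rule mult_left_mono[OF _ N])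
  then have "harmonic_jacobian h g z \<le> N * q\<^sup>2 * ((1 + r) / (1 - r))"
    using r by (simp add: J divide_simps mult.assoc)
  moreover have "N * q\<^sup>2 * ((1 + r) / (1 - r)) \<le> (1 + r)\<^sup>2 / (1 - r) ^ 6 * ((1 + r) / (1 - r))"
    using dist r by (intro mult_right_mono) auto
  moreover have "(1 + r)\<^sup>2 / (1 - r) ^ 6 * ((1 + r) / (1 - r)) = (1 + r) ^ 3 / (1 - r) ^ 7"
    by (simp add: eval_nat_numeral mult_ac)
  ultimately show "harmonic_jacobian h g z \<le> (1 + cmod z) ^ 3 / (1 - cmod z) ^ 7"
    by (simp add: r_def)
qed

lemma class_SH_S_jacobian_bounds:
  assumes f: "f \<in> class_SH_S" and hg: "canonical_decomp f h g" and z: "z \<in> \<bbbD>"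
  shows "(1 - (cmod (dbar f 0))\<^sup>2) * ((1 - cmod z) ^ 3 / (1 + cmod z) ^ 7) \<le> harmonic_jacobian h g z"
    and "harmonic_jacobian h g z \<le> (1 - (cmod (dbar f 0))\<^sup>2) * ((1 + cmod z) ^ 3 / (1 - cmod z) ^ 7)"
proof -
  obtain f0 c where f0: "f0 \<in> class_SH0_S" and c: "c \<in> \<bbbD>"
    and f_eq: "\<And>z. z \<in> \<bbbD> \<Longrightarrow> f z = f0 z + c * cnj (f0 z)"
    using f by (auto simp: class_SH_S_def)
  \<comment> \<open>Positivity of the Jacobian and univalence of the shear come with possibly
    different decompositions of \<open>f0\<close>; uniqueness transfers the former to the
    latter.\<close>
  obtain h1 g1 where 1: "canonical_decomp f0 h1 g1" "\<And>z. z \<in> \<bbbD> \<Longrightarrow> harmonic_jacobian h1 g1 z > 0"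
    using f0 by (auto simp: class_SH0_S_def class_SH0_def class_SH_def)
  obtain h0 g0 \<theta> where 0: "canonical_decomp f0 h0 g0"
    and S: "(\<lambda>z. h0 z + exp (\<i> * of_real \<theta>) * g0 z) \<in> class_S"
    using f0 by (auto simp: class_SH0_S_def)
  have g0: "deriv g0 0 = 0"
    using f0 dbar_canonical_decomp[OF 0, of 0] by (simp add: class_SH0_S_def class_SH0_def)
  have sense: "harmonic_jacobian h0 g0 z > 0" if "z \<in> \<bbbD>" for z
    using 1(2)[OF that] harmonic_jacobian_unique[OF 0 1(1) that] by simp
  have J: "harmonic_jacobian h g z = (1 - (cmod c)\<^sup>2) * harmonic_jacobian h0 g0 z"
    using harmonic_jacobian_unique[OF hg canonical_decomp_affine(1)[OF 0 g0 f_eq] z]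
      canonical_decomp_affine(2)[OF 0 g0 f_eq z] by simp
  have dbar: "dbar f 0 = c" by (rule canonical_decomp_affine(3)[OF 0 g0 f_eq])
  have pos: "1 - (cmod c)\<^sup>2 \<ge> 0" using c by (simp add: abs_square_le_1)
  have "h0 holomorphic_on \<bbbD>" "g0 holomorphic_on \<bbbD>" "cmod (exp (\<i> * of_real \<theta>)) = 1"
    using 0 by (auto simp: canonical_decomp_def)
  then have "(1 - cmod z) ^ 3 / (1 + cmod z) ^ 7 \<le> harmonic_jacobian h0 g0 z"
    "harmonic_jacobian h0 g0 z \<le> (1 + cmod z) ^ 3 / (1 - cmod z) ^ 7"
    using shear_jacobian_bounds[of h0 g0 "exp (\<i> * of_real \<theta>)" z] g0 sense S z by blast+
  from this[THEN mult_left_mono, OF pos]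
  show "(1 - (cmod (dbar f 0))\<^sup>2) * ((1 - cmod z) ^ 3 / (1 + cmod z) ^ 7) \<le> harmonic_jacobian h g z"
    "harmonic_jacobian h g z \<le> (1 - (cmod (dbar f 0))\<^sup>2) * ((1 + cmod z) ^ 3 / (1 - cmod z) ^ 7)"
    unfolding J dbar .
qed

subsection \<open>The harmonic Koebe function\<close>

definition koebe_h :: "complex \<Rightarrow> complex" where
  "koebe_h z = (z - 1/2 * z^2 + 1/6 * z^3) / (1 - z)^3"

definition koebe_g :: "complex \<Rightarrow> complex" where
  "koebe_g z = (1/2 * z^2 + 1/6 * z^3) / (1 - z)^3"

definition cayley :: "complex \<Rightarrow> complex" where
  "cayley z = (1 + z) / (1 - z)"

lemma unit_disc_neq_1: "z \<in> \<bbbD> \<Longrightarrow> 1 - z \<noteq> 0"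
  by auto

text \<open>The quotient of the two derivatives is z, so the dilatation attains the Schwarz bound
  everywhere.\<close>

lemma koebe_deriv:
  assumes "z \<in> \<bbbD>"
  shows "(koebe_h has_field_derivative (1 + z) / (1 - z) ^ 4) (at z)"
    and "(koebe_g has_field_derivative z * (1 + z) / (1 - z) ^ 4) (at z)"
proof -
  note nz = unit_disc_neq_1[OF assms]
  have "(koebe_h has_field_derivative
      ((1 - z + 1/2 * z^2) * (1 - z)^3 + (z - 1/2 * z^2 + 1/6 * z^3) * (3 * (1 - z)^2)) / ((1 - z)^3 * (1 - z)^3)) (at z)"
    unfolding koebe_h_def using nz by (auto intro!: derivative_eq_intros)
  also have "((1 - z + 1/2 * z^2) * (1 - z)^3 + (z - 1/2 * z^2 + 1/6 * z^3) * (3 * (1 - z)^2)) / ((1 - z)^3 * (1 - z)^3)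
      = (1 + z) / (1 - z) ^ 4"
    using nz by (simp add: frac_eq_eq) (simp add: field_simps eval_nat_numeral)
  finally show "(koebe_h has_field_derivative (1 + z) / (1 - z) ^ 4) (at z)" .
  have "(koebe_g has_field_derivative
      ((z + 1/2 * z^2) * (1 - z)^3 + (1/2 * z^2 + 1/6 * z^3) * (3 * (1 - z)^2)) / ((1 - z)^3 * (1 - z)^3)) (at z)"
    unfolding koebe_g_def using nz by (auto intro!: derivative_eq_intros)
  also have "((z + 1/2 * z^2) * (1 - z)^3 + (1/2 * z^2 + 1/6 * z^3) * (3 * (1 - z)^2)) / ((1 - z)^3 * (1 - z)^3)
      = z * (1 + z) / (1 - z) ^ 4"
    using nz by (simp add: frac_eq_eq) (simp add: field_simps eval_nat_numeral)
  finally show "(koebe_g has_field_derivative z * (1 + z) / (1 - z) ^ 4) (at z)" .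
qed

lemma koebe_canonical_decomp: "canonical_decomp harmonic_koebe koebe_h koebe_g"
proof -
  have "koebe_h holomorphic_on \<bbbD>" "koebe_g holomorphic_on \<bbbD>"
    using koebe_deriv holomorphic_on_open[OF open_ball] by blast+
  moreover have "deriv koebe_h 0 = 1"
    using DERIV_imp_deriv[OF koebe_deriv(1)[of 0]] by simp
  ultimately show ?thesis
    unfolding canonical_decomp_def harmonic_koebe_def koebe_h_def[symmetric] koebe_g_def[symmetric]
    by (simp add: koebe_h_def koebe_g_def)
qed

lemma koebe_deriv_g_0: "deriv koebe_g 0 = 0"
  using DERIV_imp_deriv[OF koebe_deriv(2)[of 0]] by simp

lemma koebe_jacobian:
  assumes "z \<in> \<bbbD>"
  shows "harmonic_jacobian koebe_h koebe_g z = (cmod (1 + z))\<^sup>2 * (1 - (cmod z)\<^sup>2) / cmod (1 - z) ^ 8"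
proof -
  have "cmod (1 - z) ^ 8 = (cmod (1 - z) ^ 4)\<^sup>2" by (simp flip: power_mult)
  then show ?thesis
    unfolding harmonic_jacobian_def DERIV_imp_deriv[OF koebe_deriv(1)[OF assms]]
      DERIV_imp_deriv[OF koebe_deriv(2)[OF assms]]
    by (simp add: norm_divide norm_mult norm_power power_divide power_mult_distrib)
       (simp add: diff_divide_distrib left_diff_distrib right_diff_distrib mult.commute)
qed

lemma koebe_jacobian_pos: "z \<in> \<bbbD> \<Longrightarrow> harmonic_jacobian koebe_h koebe_g z > 0"
proof -
  assume z: "z \<in> \<bbbD>"
  then have "1 - z \<noteq> 0" "1 + z \<noteq> 0" "(cmod z)\<^sup>2 < 1"
    by (auto simp: abs_square_less_1 add_eq_0_iff)
  then show ?thesis by (simp add: koebe_jacobian[OF z])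
qed

section \<open>The half-plane coordinate, injectivity and range\<close>

lemma cayley_Re_pos: "z \<in> \<bbbD> \<Longrightarrow> Re (cayley z) > 0"
proof -
  assume z: "z \<in> \<bbbD>"
  have "Re (cayley z) = (1 - (cmod z)\<^sup>2) / (cmod (1 - z))\<^sup>2"
    unfolding cayley_def Re_divide cmod_power2 by (simp add: power2_eq_square algebra_simps)
  also have "\<dots> > 0"
    using z unit_disc_neq_1[OF z] by (intro divide_pos_pos) (auto simp: abs_square_less_1)
  finally show ?thesis .
qed

lemma cayley_surj:
  assumes "Re u > 0"
  shows "\<exists>z\<in>\<bbbD>. cayley z = u"
proof
  have nz: "u + 1 \<noteq> 0" using assms by (auto simp: complex_eq_iff)
  have "(cmod (u - 1))\<^sup>2 < (cmod (u + 1))\<^sup>2"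
    unfolding cmod_power2 using assms by (simp add: power2_eq_square algebra_simps)
  then have "cmod (u - 1) < cmod (u + 1)" by (simp add: power2_less_imp_less)
  then show "(u - 1) / (u + 1) \<in> \<bbbD>" using nz by (simp add: norm_divide)
  have "1 + (u - 1) / (u + 1) = 2 * u / (u + 1)" "1 - (u - 1) / (u + 1) = 2 / (u + 1)"
    using nz by (simp_all add: field_simps)
  then show "cayley ((u - 1) / (u + 1)) = u" using nz by (simp add: cayley_def)
qed

lemma cayley_inj: "inj_on cayley \<bbbD>"
proof (rule inj_onI)
  fix z w assume "z \<in> \<bbbD>" "w \<in> \<bbbD>" "cayley z = cayley w"
  then have "(1 + z) * (1 - w) = (1 + w) * (1 - z)"
    using unit_disc_neq_1 by (simp add: cayley_def frac_eq_eq)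
  then show "z = w" by (simp add: algebra_simps)
qed

lemma koebe_cayley:
  assumes "z \<in> \<bbbD>"
  shows "koebe_h z + koebe_g z = (cayley z ^ 3 - 1) / 6"
    and "koebe_h z - koebe_g z = (cayley z ^ 2 - 1) / 4"
proof -
  note nz = unit_disc_neq_1[OF assms]
  \<comment> \<open>Abstracting 1 - z to \<open>d\<close> clears the denominators once and leaves a
    polynomial identity to check.\<close>
  have add: "a / d ^ 3 + b / d ^ 3 = (c / d ^ 3 - 1) / 6"
    if "d \<noteq> 0" "6 * (a + b) = c - d ^ 3" for a b c d :: complex
  proof -
    have "a / d ^ 3 + b / d ^ 3 = 6 * (a + b) / d ^ 3 / 6" by (simp add: add_divide_distrib)
    then show ?thesis unfolding that(2) using that(1) by (simp add: diff_divide_distrib)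
  qed
  have sub: "a / d ^ 3 - b / d ^ 3 = (c / d\<^sup>2 - 1) / 4"
    if "d \<noteq> 0" "4 * (a - b) = d * (c - d\<^sup>2)" for a b c d :: complex
  proof -
    have "a / d ^ 3 - b / d ^ 3 = 4 * (a - b) / d ^ 3 / 4" by (simp add: diff_divide_distrib)
    then show ?thesis unfolding that(2) using that(1)
      by (simp add: diff_divide_distrib power2_eq_square power3_eq_cube)
  qed
  show "koebe_h z + koebe_g z = (cayley z ^ 3 - 1) / 6"
    unfolding koebe_h_def koebe_g_def cayley_def power_divide
    by (rule add[OF nz]) (simp add: power2_eq_square power3_eq_cube algebra_simps)
  show "koebe_h z - koebe_g z = (cayley z ^ 2 - 1) / 4"
    unfolding koebe_h_def koebe_g_def cayley_def power_divide
    by (rule sub[OF nz]) (simp add: power2_eq_square power3_eq_cube algebra_simps)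
qed

text \<open>Since \<open>K = Re (h + g) + \<i> Im (h - g)\<close>, the half-plane coordinate turns \<open>K\<close> into a polynomial.\<close>

lemma harmonic_koebe_cayley:
  assumes z: "z \<in> \<bbbD>" and u: "cayley z = Complex a b"
  shows "harmonic_koebe z = Complex ((a ^ 3 - 3 * a * b\<^sup>2 - 1) / 6) (a * b / 2)"
proof -
  have K: "harmonic_koebe z = koebe_h z + cnj (koebe_g z)"
    by (simp add: harmonic_koebe_def koebe_h_def koebe_g_def)
  have "Re (harmonic_koebe z) = Re (koebe_h z + koebe_g z)"
    "Im (harmonic_koebe z) = Im (koebe_h z - koebe_g z)"
    by (simp_all add: K)
  then show ?thesis
    unfolding koebe_cayley[OF z] u
    by (simp add: complex_eq_iff power2_eq_square power3_eq_cube algebra_simps)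
qed

text \<open>The difference h - g is the analytic Koebe function (u^2 - 1)/4 with u =
  \<open>cayley z\<close>, and squaring is injective on the right half-plane.\<close>

lemma koebe_in_class_S: "(\<lambda>z. koebe_h z - koebe_g z) \<in> class_S"
proof -
  have "inj_on (\<lambda>z. koebe_h z - koebe_g z) \<bbbD>"
  proof (rule inj_onI)
    fix z w assume z: "z \<in> \<bbbD>" and w: "w \<in> \<bbbD>" and "koebe_h z - koebe_g z = koebe_h w - koebe_g w"
    then have "cayley z ^ 2 = cayley w ^ 2"
      by (simp add: koebe_cayley(2))
    then have "cayley z = cayley w \<or> cayley z = - cayley w"
      by (simp add: power2_eq_iff)
    then have "cayley z = cayley w"
      using cayley_Re_pos[OF z] cayley_Re_pos[OF w] by (metis uminus_complex.sel(1) less_asym neg_0_less_iff_less)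
    then show "z = w" using inj_onD[OF cayley_inj] z w by blast
  qed
  moreover have "((\<lambda>z. koebe_h z - koebe_g z) has_field_derivative 1 - 0) (at 0)"
    using DERIV_diff[OF koebe_deriv(1)[of 0] koebe_deriv(2)[of 0]] by simp
  then have "deriv (\<lambda>z. koebe_h z - koebe_g z) 0 = 1"
    by (simp add: DERIV_imp_deriv)
  ultimately show ?thesis
    using koebe_canonical_decomp
    by (auto simp: class_S_def canonical_decomp_def intro: holomorphic_on_diff)
qed

text \<open>Equal imaginary parts fix the product k = a b. For fixed k the real part is governed by
  a^3 - 3 k^2 / a, strictly increasing for a > 0, so it determines a and then b.\<close>

lemma harmonic_koebe_inj: "inj_on harmonic_koebe \<bbbD>"
proof (rule inj_onI)
  fix z w assume z: "z \<in> \<bbbD>" and w: "w \<in> \<bbbD>" and eq: "harmonic_koebe z = harmonic_koebe w"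
  obtain a b where u: "cayley z = Complex a b" by (cases "cayley z")
  obtain c d where v: "cayley w = Complex c d" by (cases "cayley w")
  have ac: "a > 0" "c > 0" using cayley_Re_pos[OF z] cayley_Re_pos[OF w] u v by auto
  have im: "a * b = c * d" and re: "a ^ 3 - 3 * a * b\<^sup>2 = c ^ 3 - 3 * c * d\<^sup>2"
    using eq by (auto simp: harmonic_koebe_cayley[OF z u] harmonic_koebe_cayley[OF w v])
  have mono: "x ^ 3 - 3 * x * p\<^sup>2 < y ^ 3 - 3 * y * q\<^sup>2"
    if "0 < x" "x < y" "x * p = y * q" for x y p q :: real
  proof -
    have "x * p\<^sup>2 = (x * p)\<^sup>2 / x"
      using that(1) by (simp add: power2_eq_square)
    moreover have "y * q\<^sup>2 = (x * p)\<^sup>2 / y"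
      unfolding that(3) using that(1,2) by (simp add: power2_eq_square)
    moreover have "(x * p)\<^sup>2 / y \<le> (x * p)\<^sup>2 / x"
      using that by (intro divide_left_mono) auto
    moreover have "x ^ 3 < y ^ 3" using that by (intro power_strict_mono) auto
    ultimately show ?thesis by linarith
  qed
  have "a = c"
    using mono[OF ac(1) _ im] mono[OF ac(2) _ im[symmetric]] re by (metis linorder_neqE_linordered_idom order_less_irrefl)
  then have "cayley z = cayley w" using im ac u v by simp
  then show "z = w" using inj_onD[OF cayley_inj] z w by blast
qed

text \<open>Solves for the real part \<open>a\<close> of a half-plane point when a b = q is
  prescribed. Multiplied by a, the equation becomes a quartic that is negative at 0 for nonzero q
  and nonnegative at \<open>B\<close>; for q = 0 a cube root suffices.\<close>

lemma quartic_root_pos: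
  fixes p q :: real
  assumes "q \<noteq> 0 \<or> p > 0"
  shows "\<exists>a>0. a ^ 3 - 3 * q\<^sup>2 / a = p"
proof (cases "q = 0")
  case True
  then have "root 3 p > 0" "root 3 p ^ 3 = p" using assms by simp_all
  then show ?thesis using True by (intro exI[of _ "root 3 p"]) simp
next
  case False
  define B where "B = 1 + \<bar>p\<bar> + 3 * q\<^sup>2"
  have B: "B \<ge> 1" by (simp add: B_def)
  have "B * (\<bar>p\<bar> + 3 * q\<^sup>2) \<le> B * B" using B by (intro mult_left_mono) (auto simp: B_def)
  also have "\<dots> \<le> B ^ 4" using power_increasing[OF _ B, of 2 4] by (simp add: power2_eq_square)
  finally have "B * \<bar>p\<bar> + B * (3 * q\<^sup>2) \<le> B ^ 4" by (simp add: distrib_left)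
  moreover have "1 * (3 * q\<^sup>2) \<le> B * (3 * q\<^sup>2)" using B by (intro mult_right_mono) auto
  moreover have "B * p \<le> B * \<bar>p\<bar>" using B by (intro mult_left_mono) auto
  ultimately have hi: "B ^ 4 - p * B - 3 * q\<^sup>2 \<ge> 0" by (simp add: mult.commute)
  have lo: "0 ^ 4 - p * 0 - 3 * q\<^sup>2 < 0" using False by simp
  have "\<exists>a. 0 \<le> a \<and> a \<le> B \<and> a ^ 4 - p * a - 3 * q\<^sup>2 = 0"
    by (rule IVT'[of "\<lambda>a. a ^ 4 - p * a - 3 * q\<^sup>2"]) (use hi lo B in \<open>auto intro!: continuous_intros\<close>)
  then obtain a where a: "0 \<le> a" "a ^ 4 - p * a - 3 * q\<^sup>2 = 0" by blast
  then have "a > 0" using lo by (cases "a = 0") auto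
  moreover have "a ^ 3 - 3 * q\<^sup>2 / a = p"
    using a \<open>a > 0\<close> by (simp add: field_simps eval_nat_numeral)
  ultimately show ?thesis by blast
qed

lemma harmonic_koebe_range: "- (harmonic_koebe ` \<bbbD>) = {w. Im w = 0 \<and> Re w \<le> - (1 / 6)}"
proof (intro set_eqI iffI)
  fix w assume w: "w \<in> - (harmonic_koebe ` \<bbbD>)"
  show "w \<in> {w. Im w = 0 \<and> Re w \<le> - (1 / 6)}"
  proof (rule ccontr)
    assume "w \<notin> {w. Im w = 0 \<and> Re w \<le> - (1 / 6)}"
    then have "2 * Im w \<noteq> 0 \<or> 6 * Re w + 1 > 0" by auto
    \<comment> \<open>Matching coordinates in \<open>harmonic_koebe_cayley\<close> requires a b = 2
      Im w and a^3 - 3 a b^2 = 6 Re w + 1.\<close>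
    then obtain a where a: "a > 0" "a ^ 3 - 3 * (2 * Im w)\<^sup>2 / a = 6 * Re w + 1"
      using quartic_root_pos by blast
    define b where "b = 2 * Im w / a"
    obtain z where z: "z \<in> \<bbbD>" "cayley z = Complex a b"
      using cayley_surj[of "Complex a b"] a by auto
    have "3 * a * b\<^sup>2 = 3 * (2 * Im w)\<^sup>2 / a" "a * b = 2 * Im w"
      using a by (simp_all add: b_def power2_eq_square field_simps)
    then have "harmonic_koebe z = w"
      unfolding harmonic_koebe_cayley[OF z] using a by (simp add: complex_eq_iff)
    then show False using w z by blast
  qed
next
  fix w assume w: "w \<in> {w. Im w = 0 \<and> Re w \<le> - (1 / 6)}"
  have False if z: "z \<in> \<bbbD>" and "w = harmonic_koebe z" for z
  proof -
    obtain a b where u: "cayley z = Complex a b" by (cases "cayley z")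
    then have "a > 0" using cayley_Re_pos[OF z] by simp
    \<comment> \<open>On the slit a > 0 forces b = 0, and then a^3 <= 0 is impossible.\<close>
    moreover have "a * b = 0" "a ^ 3 - 3 * a * b\<^sup>2 \<le> 0"
      using w that harmonic_koebe_cayley[OF z u] by auto
    ultimately show False by (auto simp: zero_less_power not_le[symmetric])
  qed
  then show "w \<in> - (harmonic_koebe ` \<bbbD>)" by blast
qed

section \<open>Affine images of the slit plane\<close>

lemma real_affine_bij:
  assumes c: "cmod c < 1"
  shows "linear (\<lambda>w. w + c * cnj w)" and "bij (\<lambda>w. w + c * cnj w)"
proof -
  show lin: "linear (\<lambda>w. w + c * cnj w)"
    by (auto simp: linear_iff algebra_simps)
  have "w = 0" if "w + c * cnj w = 0" for w
  proof (rule ccontr)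
    assume "w \<noteq> 0"
    have "cmod w = cmod c * cmod w"
      using that by (metis add_eq_0_iff complex_mod_cnj norm_minus_cancel norm_mult)
    then show False using c \<open>w \<noteq> 0\<close> by simp
  qed
  then have "inj (\<lambda>w. w + c * cnj w)"
    using linear_injective_0[OF lin] by blast
  then show "bij (\<lambda>w. w + c * cnj w)"
    using linear_inj_imp_surj[OF lin] by (simp add: bij_def)
qed

text \<open>A bijective real-linear map carries the slit to another half-line, so the complement is
  covered by a single half-line and the disjointness condition is vacuous.\<close>

lemma close_to_convex_domain_affine_slit:
  assumes c: "cmod c < 1" and conn: "connected ((\<lambda>w. w + c * cnj w) ` (harmonic_koebe ` \<bbbD>))"
  shows "close_to_convex_domain ((\<lambda>w. w + c * cnj w) ` (harmonic_koebe ` \<bbbD>))"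
proof -
  define L where "L = (\<lambda>w. w + c * cnj w)"
  have lin: "linear L" and bij: "bij L"
    using real_affine_bij[OF c] by (simp_all add: L_def)
  have slit: "{w. Im w = 0 \<and> Re w \<le> - (1 / 6)} = {- (1 / 6) + t *\<^sub>R (- 1) |t. t \<ge> 0}"
  proof (intro set_eqI iffI)
    fix w assume "w \<in> {w. Im w = 0 \<and> Re w \<le> - (1 / 6)}"
    then show "w \<in> {- (1 / 6) + t *\<^sub>R (- 1) |t. t \<ge> 0}"
      by (intro CollectI exI[of _ "- Re w - 1 / 6"]) (auto simp: complex_eq_iff)
  qed (auto simp: complex_eq_iff)
  have compl: "- (L ` (harmonic_koebe ` \<bbbD>)) = {L (- (1 / 6)) + t *\<^sub>R L (- 1) |t. t \<ge> 0}"
  proof -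
    have "- (L ` (harmonic_koebe ` \<bbbD>)) = L ` {- (1 / 6) + t *\<^sub>R (- 1) |t. t \<ge> 0}"
      unfolding bij_image_Compl_eq[OF bij, symmetric] harmonic_koebe_range slit ..
    also have "\<dots> = {L (- (1 / 6) + t *\<^sub>R (- 1)) |t. t \<ge> 0}"
      by blast
    also have "\<dots> = {L (- (1 / 6)) + t *\<^sub>R L (- 1) |t. t \<ge> 0}"
      unfolding linear_add[OF lin] linear_scale[OF lin] ..
    finally show ?thesis .
  qed
  have "L (- 1) \<noteq> 0"
    using bij linear_0[OF lin] by (metis bij_def injD neg_equal_0_iff_equal zero_neq_one)
  then have half_line: "closed_half_line (- (L ` (harmonic_koebe ` \<bbbD>)))"
    unfolding closed_half_line_def compl by blast
  have "closed {w. Im w = 0 \<and> Re w \<le> - (1 / 6)}"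
    by (intro closed_Collect_conj closed_Collect_eq closed_Collect_le continuous_intros)
  then have "open (harmonic_koebe ` \<bbbD>)"
    unfolding harmonic_koebe_range[symmetric] by (simp add: closed_def)
  then have "open (L ` (harmonic_koebe ` \<bbbD>))"
    using open_surjective_linear_image[OF _ lin] bij by (simp add: bij_def)
  then show ?thesis
    using conn half_line unfolding close_to_convex_domain_def L_def[symmetric]
    by (auto intro!: exI[of _ "{- (L ` (harmonic_koebe ` \<bbbD>))}"])
qed

lemma harmonic_koebe_in_class_SH0_S: "harmonic_koebe \<in> class_SH0_S"
proof -
  have "harmonic_koebe \<in> class_SH0"
    using koebe_canonical_decomp koebe_jacobian_pos harmonic_koebe_inj
      dbar_canonical_decomp[OF koebe_canonical_decomp, of 0] koebe_deriv_g_0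
    unfolding class_SH0_def class_SH_def by fastforce
  \<comment> \<open>The angle pi gives the factor -1 and hence the shear h - g.\<close>
  moreover have "(\<lambda>z. koebe_h z + exp (\<i> * of_real pi) * koebe_g z) \<in> class_S"
    using koebe_in_class_S by simp
  ultimately show ?thesis
    using koebe_canonical_decomp unfolding class_SH0_S_def by blast
qed

lemma harmonic_koebe_affine_extremal:
  assumes b: "b \<in> \<bbbD>" and f_def: "f = (\<lambda>z. harmonic_koebe z + cnj (b * harmonic_koebe z))"
  shows "f \<in> class_SH_S" and "close_to_convex f" and "dbar f 0 = cnj b"
    and "canonical_decomp f h g \<Longrightarrow> z \<in> \<bbbD> \<Longrightarrow> harmonic_jacobian h g z =
      (1 - (cmod b)\<^sup>2) * ((cmod (1 + z))\<^sup>2 * (1 - (cmod z)\<^sup>2) / cmod (1 - z) ^ 8)"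
proof -
  let ?L = "\<lambda>w. w + cnj b * cnj w"
  \<comment> \<open>Conjugating the product makes \<open>cnj b\<close> the affine parameter, hence
    the value of \<open>dbar f 0\<close>; the Jacobian sees only its modulus.\<close>
  have f: "f z = harmonic_koebe z + cnj b * cnj (harmonic_koebe z)" for z
    by (simp add: f_def)
  have b': "cnj b \<in> \<bbbD>" using b by simp
  show "f \<in> class_SH_S"
    unfolding class_SH_S_def using harmonic_koebe_in_class_SH0_S b' f by blast
  note affine = canonical_decomp_affine[OF koebe_canonical_decomp koebe_deriv_g_0 f]
  show "dbar f 0 = cnj b" by (rule affine(3))
  have pos: "1 - (cmod b)\<^sup>2 > 0" using b by (simp add: abs_square_less_1)
  have "inj_on f \<bbbD>"
  proof -
    have "inj ?L" using real_affine_bij(2)[of "cnj b"] b by (simp add: bij_def)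
    then have "inj_on (?L \<circ> harmonic_koebe) \<bbbD>"
      using harmonic_koebe_inj by (intro comp_inj_on) (auto intro: inj_on_subset)
    then show ?thesis by (simp add: o_def f[abs_def])
  qed
  then have SH: "f \<in> class_SH"
    unfolding class_SH_def using affine(1,2) koebe_jacobian_pos pos by fastforce
  have "continuous_on \<bbbD> f"
    using canonical_decomp_has_derivative[OF affine(1)]
    by (intro has_derivative_continuous_on) (auto intro: has_derivative_at_withinI)
  then have "connected (f ` \<bbbD>)"
    by (rule connected_continuous_image) simp
  moreover have "f ` \<bbbD> = ?L ` (harmonic_koebe ` \<bbbD>)"
    by (auto simp: f image_image)
  ultimately show "close_to_convex f"
    unfolding close_to_convex_def
    using SH close_to_convex_domain_affine_slit[of "cnj b"] b by simp
  show "harmonic_jacobian h g z =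
      (1 - (cmod b)\<^sup>2) * ((cmod (1 + z))\<^sup>2 * (1 - (cmod z)\<^sup>2) / cmod (1 - z) ^ 8)"
    if "canonical_decomp f h g" "z \<in> \<bbbD>"
    using harmonic_jacobian_unique[OF that(1) affine(1) that(2)] affine(2)[OF that(2)]
      koebe_jacobian[OF that(2)] by simp
qed

section \<open>Two-sided bounds and their equality cases\<close>

theorem theorem3:
  "(\<forall>f h g b1. f \<in> class_SH_S \<longrightarrow> canonical_decomp f h g \<longrightarrow> b1 = dbar f 0 \<longrightarrow>
      (\<forall>z\<in>\<bbbD>.
         (1 - (cmod b1)\<^sup>2) * ((1 - cmod z)^3 / (1 + cmod z)^7) \<le> harmonic_jacobian h g z \<and>
         harmonic_jacobian h g z \<le> (1 - (cmod b1)\<^sup>2) * ((1 + cmod z)^3 / (1 - cmod z)^7))) \<and>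
   (\<forall>b1\<in>\<bbbD>. \<forall>f. f = (\<lambda>z. harmonic_koebe z + cnj (b1 * harmonic_koebe z)) \<longrightarrow>
      f \<in> class_SH_S \<and> close_to_convex f \<and> dbar f 0 = cnj b1 \<and>
      (\<forall>h g. canonical_decomp f h g \<longrightarrow>
         (\<forall>r\<in>{0..<1}.
            (\<exists>z. cmod z = r \<and>
                 harmonic_jacobian h g z = (1 - (cmod b1)\<^sup>2) * ((1 - r)^3 / (1 + r)^7)) \<and>
            (\<exists>z. cmod z = r \<and>
                 harmonic_jacobian h g z = (1 - (cmod b1)\<^sup>2) * ((1 + r)^3 / (1 - r)^7)))))"
proof (intro conjI allI impI ballI)
  fix b f h g r
  assume b: "b \<in> \<bbbD>" and f: "f = (\<lambda>z. harmonic_koebe z + cnj (b * harmonic_koebe z))"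
    and hg: "canonical_decomp f h g" and r: "r \<in> {0..<1 :: real}"
  \<comment> \<open>Both extremes lie on the real diameter: x = r gives the upper bound, and x = - r
    turns the same formula into the lower one.\<close>
  have value_at: "harmonic_jacobian h g (of_real x) = (1 - (cmod b)\<^sup>2) * ((1 + x) ^ 3 / (1 - x) ^ 7)"
    if x: "\<bar>x\<bar> < 1" for x :: real
  proof -
    have "harmonic_jacobian h g (of_real x)
        = (1 - (cmod b)\<^sup>2) * ((cmod (1 + of_real x))\<^sup>2 * (1 - (cmod (of_real x))\<^sup>2) / cmod (1 - of_real x) ^ 8)"
      using harmonic_koebe_affine_extremal(4)[OF b f hg, of "of_real x"] x by simp
    also have "cmod (1 + of_real x) = 1 + x"
      using x norm_of_real[of "1 + x", where 'a = complex] by simp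
    also have "cmod (1 - of_real x) = 1 - x"
      using x norm_of_real[of "1 - x", where 'a = complex] by simp
    also have "(1 + x)\<^sup>2 * (1 - (cmod (of_real x))\<^sup>2) / (1 - x) ^ 8
        = ((1 + x) ^ 3 * (1 - x)) / ((1 - x) ^ 7 * (1 - x))"
      by (intro arg_cong2[where f = "(/)"]) (simp_all add: eval_nat_numeral algebra_simps)
    also have "\<dots> = (1 + x) ^ 3 / (1 - x) ^ 7"
      using x by (intro nonzero_mult_divide_mult_cancel_right) auto
    finally show ?thesis .
  qed
  show "\<exists>z. cmod z = r \<and> harmonic_jacobian h g z = (1 - (cmod b)\<^sup>2) * ((1 - r)^3 / (1 + r)^7)"
    using value_at[of "- r"] r by (intro exI[of _ "of_real (- r)"]) simp
  show "\<exists>z. cmod z = r \<and> harmonic_jacobian h g z = (1 - (cmod b)\<^sup>2) * ((1 + r)^3 / (1 - r)^7)"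
    using value_at[of r] r by (intro exI[of _ "of_real r"]) simp
qed (use class_SH_S_jacobian_bounds harmonic_koebe_affine_extremal(1-3) in auto)

end
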